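(* For any $t,N\in\mathbb{N}$ there are $K,n_0\in\mathbb{N}$ such that if $\mathcal{F}\subset[m]^n$ is $(t-1)$-avoiding with $n\ge n_0$ and $m\ge 2^{n/N}$, then there exists a subcube $D$ of co-dimension $t$ such that $\mu(\mathcal{F}\setminus D)\le 2^{-n/K}m^{-t}$.
   Context: $\mu$ is the uniform probability measure on $[m]^n$; $\mathcal{F}$ is $(t-1)$-avoiding if no $x,y\in\mathcal{F}$ satisfy $|\{i:x_i=y_i\}|=t-1$. A subcube of co-dimension $t$ is a set $\{x\in[m]^n:x_R=\alpha\}$ with $R\subset[n]$, $|R|=t$, $\alpha\in[m]^R$. *)

theory Defs
  imports "HOL-Library.FuncSet" Complex_Main
begin

definition cube :: "nat \<Rightarrow> nat \<Rightarrow> (nat \<Rightarrow> nat) set" where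
  "cube m n = PiE {..<n} (\<lambda>_. {..<m})"

definition mu :: "nat \<Rightarrow> nat \<Rightarrow> (nat \<Rightarrow> nat) set \<Rightarrow> real" where
  "mu m n A = real (card (A \<inter> cube m n)) / real m ^ n"

definition avoiding :: "nat \<Rightarrow> nat \<Rightarrow> (nat \<Rightarrow> nat) set \<Rightarrow> bool" where
  "avoiding n s F \<longleftrightarrow> (\<forall>x\<in>F. \<forall>y\<in>F. card {i\<in>{..<n}. x i = y i} \<noteq> s)"

definition subcube :: "nat \<Rightarrow> nat \<Rightarrow> nat set \<Rightarrow> (nat \<Rightarrow> nat) \<Rightarrow> (nat \<Rightarrow> nat) set" where
  "subcube m n R \<alpha> = {x\<in>cube m n. \<forall>i\<in>R. x i = \<alpha> i}"

definition is_subcube_codim :: "nat \<Rightarrow> nat \<Rightarrow> nat \<Rightarrow> (nat \<Rightarrow> nat) set \<Rightarrow> bool" where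
  "is_subcube_codim m n t D \<longleftrightarrow>
     (\<exists>R \<alpha>. R \<subseteq> {..<n} \<and> card R = t \<and> (\<forall>i\<in>R. \<alpha> i < m) \<and> D = subcube m n R \<alpha>)"

end

theory Submission
  imports Defs "HOL-Library.Disjoint_Sets" "HOL-Real_Asymp.Real_Asymp"
begin

text \<open>
  The engine is a union bound: two families that are not concentrated on any single coordinate
  contain a pair with no agreement outside prescribed coordinates. After fixing a common
  restriction of a suitable number of extra coordinates on which both families stay large, two
  pieces of an avoiding family lying in subcubes with fewer than \<open>t\<close> common constraints would
  produce a pair with exactly \<open>t - 1\<close> agreements.

  First, greedily split the family into spread pieces living in subcubes of bounded co-dimension.
  By averaging, some restriction of a block of \<open>t\<close> coordinates keeps a non-negligible part of these
  pieces alive; their subcubes are then \<open>t\<close>-intersecting, so they have a common core of size \<open>t\<close> or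
  are covered by boundedly many subcubes of co-dimension \<open>t + 1\<close>. Hence an avoiding family of measure
  more than \<open>m powr (-t-1/8)\<close> has density at least \<open>m powr (-1/2)\<close> in some subcube of co-dimension
  \<open>t\<close>.

  So, up to measure \<open>m powr (-t-1/8)\<close>, the family is covered by such dense subcubes. Cut the
  coordinates into blocks of size \<open>t\<close>. In each block the sets of alive restrictions of
  distinct dense subcubes are disjoint, so their densities \<open>p\<close> in that block sum to at most 1, while
  the density of the family in a subcube is at most twice the product of its \<open>p\<close> over the
  blocks. Two such products cannot both be larger than exponentially small, and therefore all but
  one of the subcubes contribute together an exponentially small multiple of \<open>m powr (-t)\<close>.
\<close>

section \<open>Fibres, subcubes and the union bound\<close>

definition fib :: "(nat \<Rightarrow> nat) set \<Rightarrow> nat set \<Rightarrow> (nat \<Rightarrow> nat) \<Rightarrow> (nat \<Rightarrow> nat) set" where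
  "fib P R a = {x\<in>P. \<forall>i\<in>R. x i = a i}"

text \<open>Encodes a subcube by its set of constraints (coordinate, value), so that the constraints
  shared by two subcubes become a set intersection and results on intersecting set families
  apply.\<close>

definition graph_on :: "nat set \<Rightarrow> (nat \<Rightarrow> nat) \<Rightarrow> (nat \<times> nat) set" where
  "graph_on R \<alpha> = (\<lambda>i. (i, \<alpha> i)) ` R"

lemma finite_cube [simp]: "finite (cube m n)"
  unfolding cube_def by (intro finite_PiE) auto

lemma fib_subset: "fib P R a \<subseteq> P"
  unfolding fib_def by auto

lemma finite_fib: "finite P \<Longrightarrow> finite (fib P R a)"
  unfolding fib_def by auto

lemma fib_mono: "P \<subseteq> Q \<Longrightarrow> fib P R a \<subseteq> fib Q R a"
  unfolding fib_def by auto

lemma fib_cong: "(\<And>i. i \<in> R \<Longrightarrow> a i = b i) \<Longrightarrow> fib P R a = fib P R b"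
  unfolding fib_def by auto

lemma card_graph_on: "card (graph_on R \<alpha>) = card R"
  unfolding graph_on_def by (intro card_image) (auto simp: inj_on_def)

text \<open>A point of the fibre is determined by its coordinates off \<open>R\<close>. Equality can
  fail, because the fibre is empty when \<open>a\<close> has a value out of range on
  \<open>R\<close>.\<close>

lemma card_fib_cube_le:
  assumes R: "R \<subseteq> {..<n}"
  shows "card (fib (cube m n) R a) * m ^ card R \<le> m ^ n"
proof -
  have fR: "finite R" using R finite_subset by blast
  have "card (fib (cube m n) R a) \<le> card (PiE ({..<n} - R) (\<lambda>_. {..<m}))"
  proof (rule card_inj_on_le[where f = "\<lambda>x. restrict x ({..<n} - R)"])
    show "inj_on (\<lambda>x. restrict x ({..<n} - R)) (fib (cube m n) R a)"
    proof (rule inj_onI)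
      fix x y assume x: "x \<in> fib (cube m n) R a" and y: "y \<in> fib (cube m n) R a"
        and e: "restrict x ({..<n} - R) = restrict y ({..<n} - R)"
      show "x = y"
      proof (rule PiE_ext)
        show "x \<in> PiE {..<n} (\<lambda>_. {..<m})" "y \<in> PiE {..<n} (\<lambda>_. {..<m})"
          using x y by (auto simp: fib_def cube_def)
        fix i assume i: "i \<in> {..<n}"
        show "x i = y i"
        proof (cases "i \<in> R")
          case True then show ?thesis using x y by (auto simp: fib_def)
        next
          case False then show ?thesis using fun_cong[OF e, of i] i by auto
        qed
      qed
    qed
    show "(\<lambda>x. restrict x ({..<n} - R)) ` fib (cube m n) R a \<subseteq> PiE ({..<n} - R) (\<lambda>_. {..<m})"
      by (auto simp: fib_def cube_def)
    show "finite (PiE ({..<n} - R) (\<lambda>_. {..<m}))" by (intro finite_PiE) auto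
  qed
  also have "\<dots> = m ^ (n - card R)"
    using R fR by (simp add: card_PiE card_Diff_subset)
  finally have "card (fib (cube m n) R a) * m ^ card R \<le> m ^ (n - card R) * m ^ card R" by simp
  also have "\<dots> = m ^ n"
    using card_mono[OF _ R] by (simp flip: power_add)
  finally show ?thesis .
qed

text \<open>Union bound: the points that meet \<open>y\<close> in one given coordinate form a
  fraction of at most \<open>\<kappa>\<close>, so \<open>card J\<close> coordinates cannot exhaust
  \<open>P\<close>.\<close>

lemma ex_disagreeing:
  fixes P :: "(nat \<Rightarrow> nat) set" and \<kappa> :: real
  assumes "finite P" "P \<noteq> {}" "finite J"
    and \<kappa>: "\<And>i. i \<in> J \<Longrightarrow> real (card {x\<in>P. x i = y i}) \<le> \<kappa> * card P"
    and lt: "card J * \<kappa> < 1"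
  shows "\<exists>x\<in>P. \<forall>i\<in>J. x i \<noteq> y i"
proof (rule ccontr)
  assume "\<not> ?thesis"
  then have "P \<subseteq> (\<Union>i\<in>J. {x\<in>P. x i = y i})" by auto
  then have "card P \<le> card (\<Union>i\<in>J. {x\<in>P. x i = y i})"
    using assms by (intro card_mono) auto
  also have "\<dots> \<le> (\<Sum>i\<in>J. card {x\<in>P. x i = y i})" by (rule card_UN_le) fact
  finally have "real (card P) \<le> (\<Sum>i\<in>J. real (card {x\<in>P. x i = y i}))"
    by (simp flip: of_nat_sum)
  also have "\<dots> \<le> (\<Sum>i\<in>J. \<kappa> * card P)" by (intro sum_mono \<kappa>)
  also have "\<dots> = (card J * \<kappa>) * card P" by simp
  also have "\<dots> < 1 * real (card P)"
    using lt assms by (intro mult_strict_right_mono) (auto simp: card_gt_0_iff)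
  finally show False by simp
qed

section \<open>Greedy partitions and intersecting set families\<close>

lemma greedy_partition:
  fixes F :: "'a set" and \<theta> :: real
  assumes "finite F"
    and step: "\<And>G. G \<subseteq> F \<Longrightarrow> \<theta> < card G \<Longrightarrow> \<exists>P\<subseteq>G. P \<noteq> {} \<and> \<Phi> P"
  shows "\<exists>\<P>. finite \<P> \<and> (\<forall>P\<in>\<P>. P \<subseteq> F \<and> P \<noteq> {} \<and> \<Phi> P) \<and> disjoint \<P> \<and> card (F - \<Union>\<P>) \<le> \<theta>"
  using assms
proof (induction "card F" arbitrary: F rule: less_induct)
  case less
  show ?case
  proof (cases "card F \<le> \<theta>")
    case True
    then show ?thesis by (intro exI[of _ "{}"]) auto
  next
    case False
    then obtain P where P: "P \<subseteq> F" "P \<noteq> {}" "\<Phi> P" using less.prems(2)[of F] by auto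
    have "card (F - P) < card F"
      using P less.prems(1) by (intro psubset_card_mono) auto
    moreover have "\<And>G. G \<subseteq> F - P \<Longrightarrow> \<theta> < card G \<Longrightarrow> \<exists>P\<subseteq>G. P \<noteq> {} \<and> \<Phi> P"
      using less.prems(2) by blast
    ultimately obtain \<P> where \<P>: "finite \<P>" "\<forall>Q\<in>\<P>. Q \<subseteq> F - P \<and> Q \<noteq> {} \<and> \<Phi> Q"
      "disjoint \<P>" "card (F - P - \<Union>\<P>) \<le> \<theta>"
      using less.hyps[of "F - P"] less.prems(1) by auto
    have "disjoint (insert P \<P>)"
      using \<P>(2,3) by (auto simp: disjoint_def)
    moreover have "F - \<Union>(insert P \<P>) = F - P - \<Union>\<P>" by auto
    ultimately show ?thesis using \<P> P
      by (intro exI[of _ "insert P \<P>"]) auto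
  qed
qed

text \<open>Fix a member \<open>A0\<close>. Every member contains a \<open>t\<close>-subset
  \<open>T\<close> of \<open>A0\<close>; as \<open>T\<close> is not a core, some member
  \<open>b T\<close> does not contain it, and meeting \<open>b T\<close> in \<open>t\<close> points
  forces a further point outside \<open>T\<close>. There are at most \<open>2 ^ q\<close> choices of
  \<open>T\<close> and \<open>q\<close> of the further point.\<close>

lemma intersecting_core_or_cover:
  fixes \<A> :: "'a set set"
  assumes ne: "\<A> \<noteq> {}"
    and fin: "\<And>A. A \<in> \<A> \<Longrightarrow> finite A \<and> card A \<le> q"
    and int: "\<And>A B. A \<in> \<A> \<Longrightarrow> B \<in> \<A> \<Longrightarrow> t \<le> card (A \<inter> B)"
    and nocore: "\<not> (\<exists>T. card T = t \<and> finite T \<and> T \<subseteq> \<Inter>\<A>)"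
  shows "\<exists>\<C>. finite \<C> \<and> card \<C> \<le> 2 ^ q * q \<and>
    (\<forall>C\<in>\<C>. finite C \<and> card C = t + 1 \<and> C \<subseteq> \<Union>\<A>) \<and> (\<forall>A\<in>\<A>. \<exists>C\<in>\<C>. C \<subseteq> A)"
proof -
  obtain A0 where A0: "A0 \<in> \<A>" using ne by auto
  define \<T> where "\<T> = {T. T \<subseteq> A0 \<and> card T = t}"
  have f\<T>: "finite \<T>" using fin[OF A0] by (auto simp: \<T>_def)
  have "card \<T> \<le> card (Pow A0)" using fin[OF A0] by (intro card_mono) (auto simp: \<T>_def)
  also have "\<dots> \<le> 2 ^ q" using fin[OF A0] by (simp add: card_Pow)
  finally have c\<T>: "card \<T> \<le> 2 ^ q" .
  have finT: "finite T" if "T \<in> \<T>" for T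
    using that fin[OF A0] finite_subset by (auto simp: \<T>_def)
  have "\<exists>B. B \<in> \<A> \<and> \<not> T \<subseteq> B" if T: "T \<in> \<T>" for T
  proof (rule ccontr)
    assume "\<not> ?thesis"
    then have "T \<subseteq> \<Inter>\<A>" by blast
    moreover have "card T = t" using T by (simp add: \<T>_def)
    ultimately show False using nocore finT[OF T] by blast
  qed
  then have "\<forall>T\<in>\<T>. \<exists>B. B \<in> \<A> \<and> \<not> T \<subseteq> B" by blast
  from bchoice[OF this] obtain b where b: "\<And>T. T \<in> \<T> \<Longrightarrow> b T \<in> \<A> \<and> \<not> T \<subseteq> b T" by auto
  define \<C> where "\<C> = (\<Union>T\<in>\<T>. (\<lambda>e. insert e T) ` (b T - T))"
  have "card \<C> \<le> (\<Sum>T\<in>\<T>. card ((\<lambda>e. insert e T) ` (b T - T)))"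
    unfolding \<C>_def by (rule card_UN_le) fact
  also have "\<dots> \<le> (\<Sum>T\<in>\<T>. q)"
  proof (rule sum_mono)
    fix T assume T: "T \<in> \<T>"
    have "card ((\<lambda>e. insert e T) ` (b T - T)) \<le> card (b T - T)"
      using fin b[OF T] by (intro card_image_le) auto
    also have "\<dots> \<le> card (b T)" using fin b[OF T] by (intro card_mono) auto
    also have "\<dots> \<le> q" using fin b[OF T] by auto
    finally show "card ((\<lambda>e. insert e T) ` (b T - T)) \<le> q" .
  qed
  also have "\<dots> \<le> 2 ^ q * q" using c\<T> by simp
  finally have 1: "card \<C> \<le> 2 ^ q * q" .
  have 2: "finite \<C>" unfolding \<C>_def using f\<T> fin b by auto
  have 3: "finite C \<and> card C = t + 1 \<and> C \<subseteq> \<Union>\<A>" if C: "C \<in> \<C>" for C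
  proof -
    obtain T e where T: "T \<in> \<T>" "e \<in> b T - T" "C = insert e T" using C by (auto simp: \<C>_def)
    then show ?thesis using finT[OF T(1)] b[OF T(1)] A0 by (auto simp: \<T>_def)
  qed
  have 4: "\<exists>C\<in>\<C>. C \<subseteq> A" if A: "A \<in> \<A>" for A
  proof -
    obtain T where T: "T \<subseteq> A \<inter> A0" "card T = t" "finite T"
      using obtain_subset_with_card_n[OF int[OF A A0]] by metis
    then have T': "T \<in> \<T>" by (auto simp: \<T>_def)
    \<comment> \<open>\<open>T\<close> supplies fewer than \<open>t\<close> of the points that
      \<open>A\<close> shares with \<open>b T\<close>, so one of them lies outside
      \<open>T\<close>.\<close>
    have "card (T \<inter> b T) < card T"
      using b[OF T'] T(3) by (intro psubset_card_mono) auto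
    with int[OF A, of "b T"] b[OF T'] T(2) have lt: "card (T \<inter> b T) < card (A \<inter> b T)" by auto
    have "\<not> A \<inter> b T \<subseteq> T \<inter> b T"
      using lt T(3) card_mono[of "T \<inter> b T" "A \<inter> b T"] by auto
    then obtain e where "e \<in> A" "e \<in> b T" "e \<notin> T" by auto
    then show ?thesis using T T' by (intro bexI[of _ "insert e T"]) (auto simp: \<C>_def)
  qed
  show ?thesis using 1 2 3 4 by blast
qed

lemma prod_le_prod_subset:
  fixes f :: "'a \<Rightarrow> 'b :: linordered_semidom"
  assumes "finite L" "K \<subseteq> L" "\<And>l. l \<in> L \<Longrightarrow> 0 \<le> f l \<and> f l \<le> 1"
  shows "prod f L \<le> prod f K"
proof -
  have "prod f L = prod f (L - K) * prod f K" by (rule prod.subset_diff) (use assms in auto)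
  also have "\<dots> \<le> 1 * prod f K"
    using assms by (intro mult_right_mono prod_le_1 prod_nonneg) auto
  finally show ?thesis by simp
qed

section \<open>Blocks of coordinates\<close>

definition block :: "nat \<Rightarrow> nat \<Rightarrow> nat set" where
  "block t l = {l * t..<(l + 1) * t}"

lemma card_block [simp]: "card (block t l) = t" and finite_block [simp]: "finite (block t l)"
  unfolding block_def by (auto simp: algebra_simps)

lemma block_subset: "l < n div t \<Longrightarrow> block t l \<subseteq> {..<n}"
proof -
  assume "l < n div t"
  then have "(l + 1) * t \<le> (n div t) * t" by (intro mult_right_mono) auto
  also have "\<dots> \<le> n" by simp
  finally show ?thesis by (auto simp: block_def)
qed

lemma block_div: "i \<in> block t l \<Longrightarrow> i div t = l"
  unfolding block_def by (intro div_nat_eqI) (auto simp: algebra_simps)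

lemma disjoint_block: "l \<noteq> l' \<Longrightarrow> block t l \<inter> block t l' = {}"
  using block_div by blast

text \<open>A block met by \<open>R\<close> is recovered from a point of \<open>R\<close> through
  division by \<open>t\<close>. Hence a subcube of bounded co-dimension leaves nearly all blocks
  free.\<close>

lemma card_blocks_meeting:
  assumes "finite R"
  shows "card {l. l < b \<and> block t l \<inter> R \<noteq> {}} \<le> card R"
proof -
  have "{l. l < b \<and> block t l \<inter> R \<noteq> {}} \<subseteq> (\<lambda>i. i div t) ` R"
    using block_div by (force simp: image_iff)
  then show ?thesis
    using assms by (meson card_image_le card_mono finite_imageI le_trans)
qed

section \<open>Spread pieces and alive restrictions\<close>

locale avoiding_family =
  fixes m n t :: nat and F :: "(nat \<Rightarrow> nat) set"
  assumes F_cube: "F \<subseteq> cube m n" and avoid: "avoiding n (t - 1) F"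
    and t_pos: "1 \<le> t" and m_pos: "1 \<le> m" and n_pos: "1 \<le> n"
begin

text \<open>The usual notion of a spread family, relative to the subcube given by \<open>R\<close>
  and \<open>\<alpha>\<close>. Sets \<open>S\<close> of size up to \<open>t\<close> suffice, since
  only whole blocks, or proper parts of a block with one more coordinate, are ever fixed.\<close>

definition piece :: "real \<Rightarrow> (nat \<Rightarrow> nat) set \<Rightarrow> nat set \<Rightarrow> (nat \<Rightarrow> nat) \<Rightarrow> bool" where
  "piece \<Lambda> P R \<alpha> \<longleftrightarrow> P \<subseteq> F \<and> P \<noteq> {} \<and> R \<subseteq> {..<n} \<and> (\<forall>x\<in>P. \<forall>i\<in>R. x i = \<alpha> i) \<and>
    (\<forall>S a. S \<subseteq> {..<n} - R \<longrightarrow> card S \<le> t \<longrightarrow>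
       real (card (fib P S a)) * real m ^ card S \<le> \<Lambda> * real (card P))"

text \<open>The lower bound is demanded for every part \<open>S\<close> of \<open>B\<close>, because
  the agreement argument fixes only as many coordinates of \<open>B\<close> as are missing to reach
  \<open>t - 1\<close>, and this number depends on the pair of pieces.\<close>

definition alive :: "real \<Rightarrow> (nat \<Rightarrow> nat) set \<Rightarrow> nat set \<Rightarrow> (nat \<Rightarrow> nat) set" where
  "alive \<eta> P B = {\<beta>\<in>PiE B (\<lambda>_. {..<m}). \<forall>S\<subseteq>B. (\<eta>::real) * card P \<le> card (fib P S \<beta>) * real m ^ card S}"

lemma finite_F: "finite F"
  using F_cube finite_cube finite_subset by blast

lemma pieceD:
  fixes \<Lambda> :: real
  assumes "piece \<Lambda> P R \<alpha>"
  shows "P \<subseteq> F" "P \<noteq> {}" "R \<subseteq> {..<n}" "finite P" "finite R" "card P > 0"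
    "\<And>x i. x \<in> P \<Longrightarrow> i \<in> R \<Longrightarrow> x i = \<alpha> i"
    "\<And>S a. S \<subseteq> {..<n} - R \<Longrightarrow> card S \<le> t \<Longrightarrow>
       real (card (fib P S a)) * real m ^ card S \<le> \<Lambda> * card P"
proof -
  show "P \<subseteq> F" "P \<noteq> {}" "R \<subseteq> {..<n}"
    "\<And>x i. x \<in> P \<Longrightarrow> i \<in> R \<Longrightarrow> x i = \<alpha> i"
    "\<And>S a. S \<subseteq> {..<n} - R \<Longrightarrow> card S \<le> t \<Longrightarrow>
       real (card (fib P S a)) * real m ^ card S \<le> \<Lambda> * card P"
    using assms unfolding piece_def by auto
  show "finite P" using \<open>P \<subseteq> F\<close> finite_F finite_subset by blast
  then show "card P > 0" using \<open>P \<noteq> {}\<close> by (simp add: card_gt_0_iff)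
  show "finite R" using \<open>R \<subseteq> {..<n}\<close> finite_subset by blast
qed

lemma card_alive_le: "finite B \<Longrightarrow> card (alive \<eta> P B) \<le> m ^ card B"
  using card_mono[of "PiE B (\<lambda>_. {..<m})" "alive \<eta> P B"]
  by (auto simp: alive_def card_PiE intro: finite_PiE)

lemma finite_alive: "finite B \<Longrightarrow> finite (alive \<eta> P B)"
  by (rule finite_subset[of _ "PiE B (\<lambda>_. {..<m})"]) (auto simp: alive_def intro: finite_PiE)

lemma restrict_PiE: "x \<in> cube m n \<Longrightarrow> B \<subseteq> {..<n} \<Longrightarrow> restrict x B \<in> PiE B (\<lambda>_. {..<m})"
  by (auto simp: cube_def)

text \<open>Spreadness on \<open>insert i S\<close>, which has at most \<open>t\<close> elements,
  bounds the numerator from above, and aliveness on \<open>S\<close> bounds the denominator from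
  below. The quotient is the \<open>\<kappa>\<close> for \<open>ex_disagreeing\<close>.\<close>

lemma fiber_ratio:
  fixes \<Lambda> \<eta> :: real
  assumes P: "piece \<Lambda> P R \<alpha>" and \<beta>: "\<beta> \<in> alive \<eta> P B" and \<eta>: "0 < \<eta>" and \<Lambda>: "0 \<le> \<Lambda>"
    and S: "S \<subseteq> B" "B \<subseteq> {..<n}" "B \<inter> R = {}" "card S < t" and i: "i < n" "i \<notin> R" "i \<notin> S"
  shows "real (card {x\<in>fib P S \<beta>. x i = a}) \<le> \<Lambda> / (\<eta> * m) * card (fib P S \<beta>)"
proof -
  have fS: "finite S" using S finite_subset by (metis finite_lessThan)
  have eq: "{x\<in>fib P S \<beta>. x i = a} = fib P (insert i S) (\<beta>(i := a))"
    using i by (auto simp: fib_def)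
  let ?c = "real (card {x\<in>fib P S \<beta>. x i = a})"
  have "?c * real m ^ card (insert i S) \<le> \<Lambda> * card P"
    unfolding eq using S i fS by (intro pieceD(8)[OF P]) auto
  then have "?c * real m * real m ^ card S \<le> \<Lambda> * card P"
    using i fS by (simp add: mult_ac)
  then have "\<eta> * (?c * real m * real m ^ card S) \<le> \<eta> * (\<Lambda> * card P)"
    using \<eta> by (intro mult_left_mono) auto
  also have "\<dots> = \<Lambda> * (\<eta> * card P)" by simp
  also have "\<dots> \<le> \<Lambda> * (card (fib P S \<beta>) * real m ^ card S)"
    using \<beta> S \<Lambda> by (intro mult_left_mono) (auto simp: alive_def)
  finally have "(\<eta> * m * ?c) * real m ^ card S \<le> (\<Lambda> * card (fib P S \<beta>)) * real m ^ card S"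
    by (simp add: mult_ac)
  then have "\<eta> * m * ?c \<le> \<Lambda> * card (fib P S \<beta>)"
    using m_pos by simp
  then show ?thesis using \<eta> m_pos by (simp add: field_simps)
qed

lemma alive_fib_nonempty:
  assumes P: "piece \<Lambda> P R \<alpha>" and "\<beta> \<in> alive \<eta> P B" "0 < \<eta>" "S \<subseteq> B"
  shows "fib P S \<beta> \<noteq> {}"
proof
  assume "fib P S \<beta> = {}"
  then have "\<eta> * card P \<le> 0" using assms(2,4) by (auto simp: alive_def)
  then show False using assms(3) pieceD(6)[OF P] by (simp add: mult_le_0_iff)
qed

text \<open>This is where avoidance is exploited. If the subcubes shared a set \<open>Z\<close> of
  fewer than \<open>t\<close> constraints, fixing \<open>t - 1 - card Z\<close> coordinates of
  \<open>B\<close> as in \<open>\<beta>\<close> and choosing the two points to differ everywhere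
  else would give exactly \<open>t - 1\<close> agreements.\<close>

lemma agreement_of_alive_pieces:
  fixes \<Lambda> \<eta> :: real
  assumes P: "piece \<Lambda> P R \<alpha>" and Q: "piece \<Lambda> Q R' \<alpha>'"
    and \<eta>: "0 < \<eta>" and \<Lambda>: "0 \<le> \<Lambda>" and small: "n * \<Lambda> < \<eta> * m"
    and B: "B \<subseteq> {..<n}" "card B = t" "B \<inter> R = {}" "B \<inter> R' = {}"
    and \<beta>: "\<beta> \<in> alive \<eta> P B" "\<beta> \<in> alive \<eta> Q B"
  shows "t \<le> card (graph_on R \<alpha> \<inter> graph_on R' \<alpha>')"
proof (rule ccontr)
  define Z where "Z = {i\<in>R \<inter> R'. \<alpha> i = \<alpha>' i}"
  have "graph_on R \<alpha> \<inter> graph_on R' \<alpha>' = graph_on Z \<alpha>"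
    by (auto simp: graph_on_def Z_def)
  then have cZ: "card (graph_on R \<alpha> \<inter> graph_on R' \<alpha>') = card Z" by (simp add: card_graph_on)
  assume "\<not> ?thesis"
  then have Zt: "card Z < t" using cZ by simp
  have "t - 1 - card Z \<le> card B" using B(2) by simp
  then obtain S where S: "S \<subseteq> B" "card S = t - 1 - card Z" "finite S"
    by (rule obtain_subset_with_card_n)
  have St: "card S < t" using S t_pos by linarith
  have ratio: "card J * (\<Lambda> / (\<eta> * m)) < 1" if "J \<subseteq> {..<n}" for J :: "nat set"
  proof -
    have "card J \<le> n" using card_mono[OF _ that] by simp
    then have "card J * \<Lambda> \<le> n * \<Lambda>" using \<Lambda> by (intro mult_right_mono) auto
    then show ?thesis using small \<eta> m_pos by (simp add: field_simps)
  qed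
  \<comment> \<open>\<open>y\<close> comes first: on \<open>R - R'\<close> every point of
    \<open>P\<close> equals \<open>\<alpha>\<close> and cannot be moved, so there it is
    \<open>y\<close> that has to avoid \<open>\<alpha>\<close>.\<close>
  have "\<exists>y\<in>fib Q S \<beta>. \<forall>i\<in>R - R'. y i \<noteq> \<alpha> i"
  proof (rule ex_disagreeing)
    show "finite (fib Q S \<beta>)" by (rule finite_fib[OF pieceD(4)[OF Q]])
    show "fib Q S \<beta> \<noteq> {}" by (rule alive_fib_nonempty[OF Q \<beta>(2) \<eta> S(1)])
    show "finite (R - R')" using pieceD(5)[OF P] by simp
    show "real (card {x\<in>fib Q S \<beta>. x i = \<alpha> i}) \<le> \<Lambda> / (\<eta> * m) * card (fib Q S \<beta>)"
      if "i \<in> R - R'" for i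
      using that pieceD(3)[OF P] S B St by (intro fiber_ratio[OF Q \<beta>(2) \<eta> \<Lambda>]) auto
    show "card (R - R') * (\<Lambda> / (\<eta> * m)) < 1" using pieceD(3)[OF P] by (intro ratio) auto
  qed
  then obtain y where y: "y \<in> fib Q S \<beta>" "\<forall>i\<in>R - R'. y i \<noteq> \<alpha> i" by auto
  \<comment> \<open>Off \<open>R\<close> and \<open>S\<close>, including \<open>R' - R\<close>, the
    point \<open>x\<close> is free to dodge \<open>y\<close>.\<close>
  have "\<exists>x\<in>fib P S \<beta>. \<forall>i\<in>{..<n} - R - S. x i \<noteq> y i"
  proof (rule ex_disagreeing)
    show "finite (fib P S \<beta>)" by (rule finite_fib[OF pieceD(4)[OF P]])
    show "fib P S \<beta> \<noteq> {}" by (rule alive_fib_nonempty[OF P \<beta>(1) \<eta> S(1)])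
    show "real (card {x\<in>fib P S \<beta>. x i = y i}) \<le> \<Lambda> / (\<eta> * m) * card (fib P S \<beta>)"
      if "i \<in> {..<n} - R - S" for i
      using that S B St by (intro fiber_ratio[OF P \<beta>(1) \<eta> \<Lambda>]) auto
    show "card ({..<n} - R - S) * (\<Lambda> / (\<eta> * m)) < 1" by (intro ratio) auto
  qed auto
  then obtain x where x: "x \<in> fib P S \<beta>" "\<forall>i\<in>{..<n} - R - S. x i \<noteq> y i" by auto
  have xP: "x \<in> P" and yQ: "y \<in> Q" using x y by (auto simp: fib_def)
  have "{i\<in>{..<n}. x i = y i} = S \<union> Z"
  proof (intro equalityI subsetI)
    fix i assume i: "i \<in> {i\<in>{..<n}. x i = y i}"
    show "i \<in> S \<union> Z"
    proof (cases "i \<in> R")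
      case True
      then have "y i = \<alpha> i" using i pieceD(7)[OF P xP, of i] by simp
      then have "i \<in> R'" using True y(2) by (metis DiffI)
      then show ?thesis using True i pieceD(7)[OF P xP] pieceD(7)[OF Q yQ] by (auto simp: Z_def)
    next
      case False then show ?thesis using x(2) i by auto
    qed
  next
    fix i assume "i \<in> S \<union> Z"
    then show "i \<in> {i\<in>{..<n}. x i = y i}"
    proof
      assume "i \<in> S" then show ?thesis using x y S B by (auto simp: fib_def)
    next
      assume "i \<in> Z"
      then show ?thesis using pieceD(7)[OF P xP] pieceD(7)[OF Q yQ] pieceD(3)[OF P]
        by (auto simp: Z_def)
    qed
  qed
  moreover have "S \<inter> Z = {}" using S B by (auto simp: Z_def)
  moreover have "finite Z" using pieceD(5)[OF P] by (simp add: Z_def)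
  ultimately have "card {i\<in>{..<n}. x i = y i} = t - 1"
    using S Zt by (simp add: card_Un_disjoint)
  then show False using avoid xP yQ pieceD(1)[OF P] pieceD(1)[OF Q]
    unfolding avoiding_def by blast
qed

text \<open>A non-alive restriction fails at some part \<open>S\<close> of \<open>B\<close>. For
  fixed \<open>S\<close> there are \<open>m ^ card S\<close> fibres, so the too small ones hold
  together at most \<open>\<eta> * card P\<close> points; there are \<open>2 ^ t\<close> choices of
  \<open>S\<close>.\<close>

lemma card_non_alive:
  fixes \<eta> :: real
  assumes P: "P \<subseteq> F" and B: "B \<subseteq> {..<n}" "card B = t" and \<eta>: "0 \<le> \<eta>"
  shows "real (card {x\<in>P. restrict x B \<notin> alive \<eta> P B}) \<le> 2 ^ t * \<eta> * card P"
proof -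
  have fB: "finite B" using B finite_subset by blast
  have fP: "finite P" using P finite_F finite_subset by blast
  define bad where "bad S = {x\<in>P. card (fib P S x) * real m ^ card S < \<eta> * card P}" for S
  have "{x\<in>P. restrict x B \<notin> alive \<eta> P B} \<subseteq> (\<Union>S\<in>Pow B. bad S)"
  proof
    fix x assume x: "x \<in> {x\<in>P. restrict x B \<notin> alive \<eta> P B}"
    then have "restrict x B \<in> PiE B (\<lambda>_. {..<m})" using restrict_PiE P F_cube B by blast
    then obtain S where S: "S \<subseteq> B" "card (fib P S (restrict x B)) * real m ^ card S < \<eta> * card P"
      using x by (auto simp: alive_def not_le)
    moreover have "fib P S (restrict x B) = fib P S x" using S by (intro fib_cong) auto
    ultimately show "x \<in> (\<Union>S\<in>Pow B. bad S)" using x by (auto simp: bad_def)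
  qed
  then have "card {x\<in>P. restrict x B \<notin> alive \<eta> P B} \<le> card (\<Union>S\<in>Pow B. bad S)"
    using fP fB by (intro card_mono) (auto simp: bad_def)
  also have "\<dots> \<le> (\<Sum>S\<in>Pow B. card (bad S))" using fB by (intro card_UN_le) auto
  finally have "real (card {x\<in>P. restrict x B \<notin> alive \<eta> P B}) \<le> (\<Sum>S\<in>Pow B. real (card (bad S)))"
    by (simp flip: of_nat_sum)
  also have "\<dots> \<le> (\<Sum>S\<in>Pow B. \<eta> * card P)"
  proof (rule sum_mono)
    fix S assume "S \<in> Pow B"
    then have S: "S \<subseteq> B" by simp
    then have fS: "finite S" using fB finite_subset by blast
    let ?X = "PiE S (\<lambda>_. {..<m})"
    have fX: "finite ?X" using fS by (intro finite_PiE) auto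
    have cX: "card ?X = m ^ card S" using fS by (simp add: card_PiE)
    have "bad S = (\<Union>\<gamma>\<in>?X. {x\<in>bad S. restrict x S = \<gamma>})"
      using restrict_PiE[of _ S] P F_cube S B by (auto simp: bad_def)
    then have "card (bad S) \<le> (\<Sum>\<gamma>\<in>?X. card {x\<in>bad S. restrict x S = \<gamma>})"
      using card_UN_le[OF fX, of "\<lambda>\<gamma>. {x\<in>bad S. restrict x S = \<gamma>}"] by simp
    then have "real (card (bad S)) \<le> (\<Sum>\<gamma>\<in>?X. real (card {x\<in>bad S. restrict x S = \<gamma>}))"
      by (simp flip: of_nat_sum)
    also have "\<dots> \<le> (\<Sum>\<gamma>\<in>?X. \<eta> * card P / m ^ card S)"
    proof (rule sum_mono)
      fix \<gamma> assume "\<gamma> \<in> ?X"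
      show "real (card {x\<in>bad S. restrict x S = \<gamma>}) \<le> \<eta> * card P / m ^ card S"
      proof (cases "{x\<in>bad S. restrict x S = \<gamma>} = {}")
        case True
        have "0 \<le> \<eta> * card P / m ^ card S" using \<eta> by simp
        then show ?thesis by (simp only: True card.empty of_nat_0)
      next
        case False
        then obtain x where x: "x \<in> bad S" "restrict x S = \<gamma>" by auto
        have "{x\<in>bad S. restrict x S = \<gamma>} \<subseteq> fib P S x"
          using x by (auto simp: bad_def fib_def restrict_def fun_eq_iff) metis
        then have "card {x\<in>bad S. restrict x S = \<gamma>} \<le> card (fib P S x)"
          using fP by (intro card_mono) (auto simp: fib_def)
        moreover have "card (fib P S x) * real m ^ card S < \<eta> * card P"
          using x by (simp add: bad_def)
        moreover have "card {x\<in>bad S. restrict x S = \<gamma>} * real m ^ card S \<le> card (fib P S x) * real m ^ card S"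
          using calculation(1) by (intro mult_right_mono) auto
        ultimately have "card {x\<in>bad S. restrict x S = \<gamma>} * real m ^ card S \<le> \<eta> * card P" by linarith
        then show ?thesis using m_pos by (simp add: field_simps)
      qed
    qed
    also have "\<dots> = \<eta> * card P" using m_pos by (simp add: cX)
    finally show "real (card (bad S)) \<le> \<eta> * card P" .
  qed
  also have "\<dots> = 2 ^ t * \<eta> * card P" using fB B by (simp add: card_Pow)
  finally show ?thesis .
qed

text \<open>At least half of \<open>P\<close> has an alive restriction to \<open>B\<close>, and by
  spreadness a single restriction holds at most a fraction \<open>\<Lambda> / m ^ t\<close> of
  \<open>P\<close>, so many restrictions are alive.\<close>

lemma card_alive_ge:
  fixes \<Lambda> \<eta> :: real
  assumes P: "piece \<Lambda> P R \<alpha>" and B: "B \<subseteq> {..<n}" "card B = t" "B \<inter> R = {}"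
    and \<eta>: "0 \<le> \<eta>" "2 ^ t * \<eta> \<le> 1 / 2"
  shows "real m ^ t \<le> 2 * \<Lambda> * card (alive \<eta> P B)"
proof -
  have fB: "finite B" using B finite_subset by blast
  have fP: "finite P" by (rule pieceD(4)[OF P])
  let ?g = "{x\<in>P. restrict x B \<in> alive \<eta> P B}" and ?h = "{x\<in>P. restrict x B \<notin> alive \<eta> P B}"
  have "card P = card ?g + card ?h"
    using fP by (subst card_Un_disjoint[symmetric]) (auto intro: arg_cong[where f = card])
  moreover have "real (card ?h) \<le> 1 / 2 * card P"
    using card_non_alive[OF pieceD(1)[OF P] B(1,2) \<eta>(1)] mult_right_mono[OF \<eta>(2), of "card P"]
    by simp
  ultimately have 1: "real (card P) \<le> 2 * card ?g" by linarith
  have "card ?g \<le> card (\<Union>\<beta>\<in>alive \<eta> P B. fib P B \<beta>)"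
  proof (rule card_mono)
    show "finite (\<Union>\<beta>\<in>alive \<eta> P B. fib P B \<beta>)"
      by (rule finite_subset[OF _ fP]) (auto simp: fib_def)
    show "?g \<subseteq> (\<Union>\<beta>\<in>alive \<eta> P B. fib P B \<beta>)"
      by (auto simp: fib_def intro!: bexI)
  qed
  also have "\<dots> \<le> (\<Sum>\<beta>\<in>alive \<eta> P B. card (fib P B \<beta>))"
    by (intro card_UN_le finite_alive fB)
  finally have "real (card ?g) * real m ^ t \<le> (\<Sum>\<beta>\<in>alive \<eta> P B. real (card (fib P B \<beta>))) * real m ^ t"
    by (intro mult_right_mono) (simp_all flip: of_nat_sum)
  also have "\<dots> = (\<Sum>\<beta>\<in>alive \<eta> P B. real (card (fib P B \<beta>)) * real m ^ card B)"
    by (simp add: sum_distrib_right B)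
  also have "\<dots> \<le> (\<Sum>\<beta>\<in>alive \<eta> P B. \<Lambda> * card P)"
    using B by (intro sum_mono pieceD(8)[OF P]) auto
  finally have "real (card ?g) * real m ^ t \<le> \<Lambda> * card (alive \<eta> P B) * card P" by (simp add: mult_ac)
  moreover have "real (card P) * real m ^ t \<le> 2 * card ?g * real m ^ t"
    using 1 by (intro mult_right_mono) auto
  ultimately have "real m ^ t * card P \<le> (2 * \<Lambda> * card (alive \<eta> P B)) * card P"
    by (simp add: mult_ac)
  then show ?thesis using pieceD(6)[OF P] by simp
qed

text \<open>Double counting, weighted by the sizes of the pieces. Each piece is alive at a fraction
  of at least \<open>1 / (4 * \<Lambda>)\<close> of all pairs \<open>(l, \<beta>)\<close>: a factor
  2 is lost to the blocks that meet \<open>R P\<close>, and \<open>2 * \<Lambda>\<close> comes from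
  \<open>card_alive_ge\<close>.\<close>

lemma popular_block:
  fixes \<Lambda> \<eta> :: real
  assumes \<P>: "finite \<P>" "\<And>P. P \<in> \<P> \<Longrightarrow> piece \<Lambda> P (R P) (\<alpha> P) \<and> card (R P) \<le> q"
    and b: "2 * q \<le> n div t" "1 \<le> n div t"
    and \<eta>: "0 \<le> \<eta>" "2 ^ t * \<eta> \<le> 1 / 2"
  shows "\<exists>l<n div t. \<exists>\<beta>. (\<Sum>P\<in>\<P>. real (card P)) \<le>
    4 * \<Lambda> * (\<Sum>P\<in>{P\<in>\<P>. block t l \<inter> R P = {} \<and> \<beta> \<in> alive \<eta> P (block t l)}. real (card P))"
proof (rule ccontr)
  define b where "b = n div t"
  define W where "W = (\<Sum>P\<in>\<P>. real (card P))"
  define c where "c l \<beta> P \<longleftrightarrow> block t l \<inter> R P = {} \<and> \<beta> \<in> alive \<eta> P (block t l)" for l \<beta> P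
  define I where "I = (SIGMA l:{..<b}. PiE (block t l) (\<lambda>_. {..<m}))"
  have fI: "finite I" unfolding I_def by (intro finite_SigmaI finite_PiE) auto
  have cI: "card I = b * m ^ t" unfolding I_def
    by (subst card_SigmaI) (auto simp: card_PiE intro: finite_PiE)
  assume "\<not> ?thesis"
  then have neg: "4 * \<Lambda> * (\<Sum>P\<in>{P\<in>\<P>. c l \<beta> P}. real (card P)) < W" if "l < b" for l \<beta>
    using that by (auto simp: c_def W_def b_def not_le)
  have I_ne: "I \<noteq> {}"
    using cI b m_pos by (metis b_def card.empty mult_eq_0_iff not_one_le_zero power_eq_0_iff)
  have "(\<Sum>(l,\<beta>)\<in>I. 4 * \<Lambda> * (\<Sum>P\<in>{P\<in>\<P>. c l \<beta> P}. real (card P))) < (\<Sum>(l,\<beta>)\<in>I. W)"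
    using neg by (intro sum_strict_mono fI I_ne) (auto simp: I_def)
  also have "\<dots> = b * real m ^ t * W" by (simp add: cI)
  finally have less: "(\<Sum>(l,\<beta>)\<in>I. 4 * \<Lambda> * (\<Sum>P\<in>{P\<in>\<P>. c l \<beta> P}. real (card P))) < b * real m ^ t * W" .
  have main: "b * real m ^ t \<le> 4 * \<Lambda> * card {p\<in>I. c (fst p) (snd p) P}" if P: "P \<in> \<P>" for P
  proof -
    let ?L = "{l. l < b \<and> block t l \<inter> R P = {}}" and ?L' = "{l. l < b \<and> block t l \<inter> R P \<noteq> {}}"
    have pP: "piece \<Lambda> P (R P) (\<alpha> P)" "card (R P) \<le> q" using \<P>(2)[OF P] by auto
    have "{..<b} = ?L \<union> ?L'" by auto
    then have "card ?L + card ?L' = card {..<b}"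
      by (simp only:) (rule card_Un_disjoint[symmetric], auto)
    moreover have "card ?L' \<le> q"
      using card_blocks_meeting[OF pieceD(5)[OF pP(1)]] pP(2) le_trans by blast
    ultimately have L: "b \<le> 2 * card ?L" using b by (simp add: b_def)
    have "{p\<in>I. c (fst p) (snd p) P} = (SIGMA l:?L. alive \<eta> P (block t l))"
      by (auto simp: I_def c_def alive_def)
    then have "card {p\<in>I. c (fst p) (snd p) P} = (\<Sum>l\<in>?L. card (alive \<eta> P (block t l)))"
      by (simp add: card_SigmaI finite_alive)
    then have "4 * \<Lambda> * card {p\<in>I. c (fst p) (snd p) P} = 2 * (\<Sum>l\<in>?L. 2 * \<Lambda> * card (alive \<eta> P (block t l)))"
      by (simp add: sum_distrib_left mult_ac)
    also have "\<dots> \<ge> 2 * (\<Sum>l\<in>?L. real m ^ t)"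
      using \<eta> block_subset[of _ n t]
      by (intro mult_left_mono sum_mono card_alive_ge[OF pP(1)]) (auto simp: b_def)
    finally have "2 * (card ?L * real m ^ t) \<le> 4 * \<Lambda> * card {p\<in>I. c (fst p) (snd p) P}" by simp
    moreover have "b * real m ^ t \<le> real (2 * card ?L) * real m ^ t"
      using L by (intro mult_right_mono) (simp_all del: of_nat_mult)
    ultimately show ?thesis by (simp add: mult_ac)
  qed
  have "b * real m ^ t * W = (\<Sum>P\<in>\<P>. b * real m ^ t * card P)"
    by (simp add: W_def sum_distrib_left)
  also have "\<dots> \<le> (\<Sum>P\<in>\<P>. 4 * \<Lambda> * card {p\<in>I. c (fst p) (snd p) P} * card P)"
    using main by (intro sum_mono mult_right_mono) auto
  also have "\<dots> = (\<Sum>P\<in>\<P>. \<Sum>p\<in>{p\<in>I. c (fst p) (snd p) P}. 4 * \<Lambda> * card P)"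
    by (simp add: mult_ac)
  also have "\<dots> = (\<Sum>p\<in>I. \<Sum>P\<in>{P\<in>\<P>. c (fst p) (snd p) P}. 4 * \<Lambda> * card P)"
    by (rule sum.swap_restrict) (use \<P> fI in auto)
  also have "\<dots> = (\<Sum>(l,\<beta>)\<in>I. 4 * \<Lambda> * (\<Sum>P\<in>{P\<in>\<P>. c l \<beta> P}. real (card P)))"
    by (simp add: sum_distrib_left split_def)
  finally show False using less by simp
qed

section \<open>From a large family to a dense subcube\<close>

lemma card_hits_le:
  assumes "finite C" "fst ` C \<subseteq> {..<n}"
  shows "card {x\<in>cube m n. \<forall>(i,a)\<in>C. x i = a} * m ^ card C \<le> m ^ n"
proof (cases "{x\<in>cube m n. \<forall>(i,a)\<in>C. x i = a} = {}")
  case False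
  then obtain x where x: "x \<in> cube m n" "\<forall>(i,a)\<in>C. x i = a" by auto
  have "C = graph_on (fst ` C) x" using x by (force simp: graph_on_def)
  then have "card C = card (fst ` C)" using card_graph_on by metis
  moreover have "{x\<in>cube m n. \<forall>(i,a)\<in>C. x i = a} = fib (cube m n) (fst ` C) x"
    using x(2) by (force simp: fib_def)
  ultimately show ?thesis using card_fib_cube_le[OF assms(2)] by metis
next
  \<comment> \<open>This case includes a contradictory \<open>C\<close>, which prescribes two values
    at one coordinate.\<close>
  case True
  then show ?thesis by (simp only: True card.empty)
qed

text \<open>Here \<open>v\<close> stands for \<open>m powr (1 / (8 * t))\<close>, so that only natural powers of \<open>v\<close> occur.\<close>

lemma ex_spread_piece:
  fixes v :: real
  assumes v: "1 < v" "real m = v ^ (8 * t)"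
    and G: "G \<subseteq> F" "real m ^ n / real m ^ (t + 1) < card G"
  shows "\<exists>P\<subseteq>G. P \<noteq> {} \<and> (\<exists>R \<alpha>. piece (v ^ (2 * t)) P R \<alpha> \<and> card R \<le> 4 * t * (t + 1))"
proof -
  \<comment> \<open>Each fixed coordinate is rewarded by a factor \<open>\<rho>\<close> slightly
    below \<open>m\<close>. The gap \<open>v\<^sup>2\<close> per coordinate keeps the co-dimension
    of a maximiser bounded, and costs \<open>v ^ (2 * t)\<close> in spreadness over \<open>t\<close>
    coordinates.\<close>
  define \<rho> where "\<rho> = real m / v\<^sup>2"
  have m\<rho>: "real m = \<rho> * v\<^sup>2" using v by (simp add: \<rho>_def)
  have \<rho>: "0 < \<rho>" using v m_pos by (simp add: \<rho>_def)
  define w where "w = (\<lambda>(R, a). card (fib G R a) * \<rho> ^ card R)"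
  define I where "I = Pow {..<n} \<times> cube m n"
  have fI: "finite I" by (simp add: I_def)
  have G_cube: "G \<subseteq> cube m n" using G F_cube by auto
  have fG: "finite G" using G_cube finite_cube finite_subset by blast
  have "0 \<le> real m ^ n / real m ^ (t + 1)" by simp
  then have "0 < real (card G)" using G(2) by linarith
  then obtain x0 where x0: "x0 \<in> G" by (metis card.empty equals0I less_irrefl of_nat_0)
  then have "({}, x0) \<in> I" using G_cube by (auto simp: I_def)
  then have "Max (w ` I) \<in> w ` I" using fI by (intro Max_in) auto
  then obtain p where p: "p \<in> I" "w p = Max (w ` I)" by auto
  obtain R a where pRa: "p = (R, a)" by force
  have R: "R \<subseteq> {..<n}" using p pRa by (auto simp: I_def)
  have mx: "card (fib G R' a') * \<rho> ^ card R' \<le> card (fib G R a) * \<rho> ^ card R"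
    if "R' \<subseteq> {..<n}" "a' \<in> cube m n" for R' a'
  proof -
    have "w (R', a') \<le> Max (w ` I)" using that fI by (intro Max_ge) (auto simp: I_def)
    then show ?thesis using p pRa by (simp add: w_def)
  qed
  \<comment> \<open>maximality of the weight makes the restricted family spread\<close>
  let ?P = "fib G R a"
  have big: "real (card G) \<le> card ?P * \<rho> ^ card R"
    using mx[of "{}" x0] x0 G_cube by (auto simp: fib_def)
  then have P_ne: "?P \<noteq> {}" using \<open>0 < real (card G)\<close> by (metis card.empty mult_zero_left not_le of_nat_0)
  have "card ?P \<le> card (fib (cube m n) R a)"
    by (intro card_mono fib_mono G_cube finite_subset[OF fib_subset finite_cube])
  then have "card ?P * m ^ card R \<le> m ^ n"
    using card_fib_cube_le[OF R] by (meson le_trans mult_le_mono1)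
  then have up: "card ?P * real m ^ card R \<le> real m ^ n"
    by (metis of_nat_le_iff of_nat_mult of_nat_power)
  \<comment> \<open>The maximal weight is at least \<open>card G\<close>, hence above
    \<open>m ^ n / m ^ (t + 1)\<close>, while the subcube has at most
    \<open>m ^ n / m ^ card R\<close> points. Comparing the two leaves
    \<open>v ^ (2 * card R)\<close> below \<open>m ^ (t + 1)\<close>.\<close>
  have "card R \<le> 4 * t * (t + 1)"
  proof -
    have "card ?P * \<rho> ^ card R * v ^ (2 * card R) = card ?P * real m ^ card R"
      by (simp add: m\<rho> power_mult_distrib power_mult)
    also have "\<dots> \<le> real m ^ n" by (rule up)
    also have "\<dots> < card G * real m ^ (t + 1)"
      using G(2) m_pos by (simp add: field_simps)
    also have "\<dots> \<le> card ?P * \<rho> ^ card R * real m ^ (t + 1)"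
      using big by (intro mult_right_mono) auto
    finally have "v ^ (2 * card R) < real m ^ (t + 1)"
      using \<rho> by (simp add: mult_less_cancel_left)
    also have "\<dots> = v ^ (8 * t * (t + 1))" by (simp only: v(2) power_mult)
    finally have "2 * card R < 8 * t * (t + 1)" using v by (simp only: power_strict_increasing_iff)
    then show ?thesis by simp
  qed
  moreover have "piece (v ^ (2 * t)) ?P R a"
    unfolding piece_def
  proof (intro conjI allI impI)
    show "?P \<subseteq> F" using G(1) fib_subset[of G R a] by (rule order_trans[rotated])
    show "\<forall>x\<in>?P. \<forall>i\<in>R. x i = a i" by (auto simp: fib_def)
    fix S c assume S: "S \<subseteq> {..<n} - R" "card S \<le> t"
    have fS: "finite S" "finite R" using S R finite_subset by (blast, blast)
    show "real (card (fib ?P S c)) * real m ^ card S \<le> v ^ (2 * t) * real (card ?P)"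
    proof (cases "fib ?P S c = {}")
      case True
      then show ?thesis using v by simp
    next
      case False
      then obtain x where x: "x \<in> fib ?P S c" by auto
      \<comment> \<open>The fibre is re-indexed by one of its own points, because \<open>mx\<close>
        speaks only of points of the cube.\<close>
      have eq: "fib ?P S c = fib G (R \<union> S) x" using x by (auto simp: fib_def)
      have "card (fib G (R \<union> S) x) * \<rho> ^ card (R \<union> S) \<le> card ?P * \<rho> ^ card R"
        using x S R G_cube by (intro mx) (auto simp: fib_def)
      also have "card (R \<union> S) = card R + card S"
        using S fS by (intro card_Un_disjoint) auto
      finally have "(card (fib ?P S c) * \<rho> ^ card S) * \<rho> ^ card R \<le> card ?P * \<rho> ^ card R"
        by (simp add: eq power_add mult_ac)
      then have *: "card (fib ?P S c) * \<rho> ^ card S \<le> card ?P" using \<rho> by simp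
      have "real (card (fib ?P S c)) * real m ^ card S = v ^ (2 * card S) * (card (fib ?P S c) * \<rho> ^ card S)"
        by (simp add: m\<rho> power_mult_distrib power_mult)
      also have "\<dots> \<le> v ^ (2 * t) * card ?P"
        using * v S \<rho> by (intro mult_mono power_increasing) auto
      finally show ?thesis .
    qed
  qed (use P_ne R in auto)
  ultimately show ?thesis using P_ne fib_subset[of G R a] by (intro exI[of _ ?P]) blast
qed

text \<open>As \<open>v ^ t\<close> is \<open>m powr (1 / 8)\<close>, the exponents 1/8 and 1/2
  appear as \<open>v ^ t\<close> and \<open>v ^ (4 * t)\<close>. Pieces alive at one popular
  restriction pairwise share \<open>t\<close> constraints; without a common core they would fit into
  boundedly many subcubes of co-dimension \<open>t + 1\<close>, which are too small.\<close>

lemma ex_dense_subcube: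
  fixes v \<eta> :: real
  assumes v: "1 < v" "real m = v ^ (8 * t)"
    and \<eta>: "0 < \<eta>" "2 ^ t * \<eta> \<le> 1 / 2" and small: "n * v ^ (4 * t) < \<eta> * m"
    and q: "q = 4 * t * (t + 1)" "2 * q \<le> n div t"
    and large: "8 * (2 ^ q * q) \<le> v ^ (5 * t)" "8 \<le> v ^ t"
    and F: "real m ^ n < card F * (real m ^ t * v ^ t)"
  shows "\<exists>T \<alpha>. T \<subseteq> {..<n} \<and> card T = t \<and> \<alpha> \<in> PiE T (\<lambda>_. {..<m}) \<and>
    real m ^ n \<le> card (fib F T \<alpha>) * (real m ^ t * v ^ (4 * t))"
proof -
  define \<theta> where "\<theta> = real m ^ n / real m ^ (t + 1)"
  have m0: "0 < real m" using m_pos by simp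
  have "\<exists>\<P>. finite \<P> \<and> (\<forall>P\<in>\<P>. P \<subseteq> F \<and> P \<noteq> {} \<and> (\<exists>R \<alpha>. piece (v ^ (2 * t)) P R \<alpha> \<and> card R \<le> q))
    \<and> disjoint \<P> \<and> card (F - \<Union>\<P>) \<le> \<theta>"
    unfolding q(1) using ex_spread_piece[OF v] by (intro greedy_partition finite_F) (auto simp: \<theta>_def)
  then obtain \<P> where \<P>: "finite \<P>" "\<forall>P\<in>\<P>. \<exists>R \<alpha>. piece (v ^ (2 * t)) P R \<alpha> \<and> card R \<le> q"
    "disjoint \<P>" "card (F - \<Union>\<P>) \<le> \<theta>" "\<forall>P\<in>\<P>. P \<subseteq> F" by blast
  from bchoice[OF \<P>(2)] obtain R where "\<forall>P\<in>\<P>. \<exists>\<alpha>. piece (v ^ (2 * t)) P (R P) \<alpha> \<and> card (R P) \<le> q"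
    by blast
  from bchoice[OF this] obtain \<alpha> where
    R\<alpha>: "\<And>P. P \<in> \<P> \<Longrightarrow> piece (v ^ (2 * t)) P (R P) (\<alpha> P) \<and> card (R P) \<le> q" by blast
  have finP: "finite P" if "P \<in> \<P>" for P using \<P>(5) that finite_F finite_subset by blast
  have cardU: "card (\<Union>\<Q>) = (\<Sum>P\<in>\<Q>. card P)" if "\<Q> \<subseteq> \<P>" for \<Q>
    using that \<P>(3) finP by (intro card_Union_disjoint) (auto simp: disjoint_def pairwise_def disjnt_def)
  define W where "W = (\<Sum>P\<in>\<P>. real (card P))"
  \<comment> \<open>Less than half of \<open>F\<close> escapes the pieces, since
    \<open>2 * v ^ t \<le> m\<close>.\<close>
  have W: "card F \<le> 2 * W"
  proof -
    have "2 * v ^ t \<le> v ^ t * v ^ t" using large(2) v(1) by (intro mult_right_mono) auto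
    also have "\<dots> = v ^ (2 * t)" by (simp add: mult_2 power_add)
    also have "\<dots> \<le> real m" unfolding v(2) using v by (intro power_increasing) auto
    finally have "2 * v ^ t \<le> real m" .
    moreover have "\<theta> * (real m ^ t * real m) = real m ^ n" using m0 by (simp add: \<theta>_def)
    moreover have "\<theta> * (real m ^ t * (2 * v ^ t)) \<le> \<theta> * (real m ^ t * real m)"
      using calculation(1) by (intro mult_left_mono) (auto simp: \<theta>_def)
    ultimately have "\<theta> * (real m ^ t * (2 * v ^ t)) \<le> real m ^ n" by linarith
    then have "(2 * \<theta>) * (real m ^ t * v ^ t) < card F * (real m ^ t * v ^ t)"
      using F by (simp add: mult_ac)
    moreover have "0 < real m ^ t * v ^ t" using m0 v(1) by simp
    ultimately have 1: "2 * \<theta> < card F" by (simp only: mult_less_cancel_right_pos)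
    have "\<Union>\<P> \<subseteq> F" using \<P>(5) by auto
    then have "card F = card (F - \<Union>\<P>) + card (\<Union>\<P>)"
      using finite_F by (metis card_Diff_subset card_mono finite_subset le_add_diff_inverse2)
    also have "\<dots> \<le> \<theta> + W" using \<P>(4) cardU[of \<P>] by (simp add: W_def)
    finally show ?thesis using 1 by simp
  qed
  have "0 < n div t" using q t_pos by (auto intro: Nat.gr0I)
  then obtain l \<beta> where l: "l < n div t" and
    l\<beta>: "W \<le> 4 * v ^ (2 * t) * (\<Sum>P\<in>{P\<in>\<P>. block t l \<inter> R P = {} \<and> \<beta> \<in> alive \<eta> P (block t l)}. real (card P))"
    using popular_block[OF \<P>(1) R\<alpha> q(2), of \<eta>] \<eta> by (auto simp: W_def)
  define \<Q> where "\<Q> = {P\<in>\<P>. block t l \<inter> R P = {} \<and> \<beta> \<in> alive \<eta> P (block t l)}"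
  have \<Q>\<P>: "\<Q> \<subseteq> \<P>" by (auto simp: \<Q>_def)
  have UF: "\<Union>\<Q> \<subseteq> F" using \<Q>\<P> \<P>(5) by blast
  have "W \<le> 4 * v ^ (2 * t) * card (\<Union>\<Q>)" using l\<beta> cardU[OF \<Q>\<P>] by (simp add: \<Q>_def)
  then have Fle: "card F \<le> 8 * v ^ (2 * t) * card (\<Union>\<Q>)" using W by simp
  have "real m ^ n < 8 * v ^ (2 * t) * card (\<Union>\<Q>) * (real m ^ t * v ^ t)"
    by (rule less_le_trans[OF F mult_right_mono[OF Fle]]) (use m0 v(1) in simp)
  also have "\<dots> = 8 * (card (\<Union>\<Q>) * (real m ^ t * v ^ (3 * t)))"
    by (simp add: power_add[symmetric])
  \<comment> \<open>The constant 8 is 2 from \<open>W\<close> times 4 from the popular block;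
    \<open>v ^ (3 * t)\<close> collects \<open>v ^ t\<close> from the size of \<open>F\<close> and
    \<open>v ^ (2 * t)\<close> from the spreadness.\<close>
  finally have mass: "real m ^ n < 8 * (card (\<Union>\<Q>) * (real m ^ t * v ^ (3 * t)))" .
  define \<A> where "\<A> = (\<lambda>P. graph_on (R P) (\<alpha> P)) ` \<Q>"
  have "\<Q> \<noteq> {}" using mass m0 by (auto simp: not_less)
  then have \<A>_ne: "\<A> \<noteq> {}" by (simp add: \<A>_def)
  have \<A>_fin: "finite A \<and> card A \<le> q" if A: "A \<in> \<A>" for A
  proof -
    obtain P where P: "P \<in> \<Q>" "A = graph_on (R P) (\<alpha> P)" using A by (auto simp: \<A>_def)
    then have "piece (v ^ (2 * t)) P (R P) (\<alpha> P)" "card (R P) \<le> q" using \<Q>\<P> R\<alpha> by auto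
    then show ?thesis using P(2) pieceD(5) by (simp add: card_graph_on) (simp add: graph_on_def)
  qed
  have v4: "v ^ (2 * t) \<le> v ^ (4 * t)" using v by (intro power_increasing) auto
  have \<A>_int: "t \<le> card (A \<inter> A')" if AA: "A \<in> \<A>" "A' \<in> \<A>" for A A'
  proof -
    obtain P Q where PQ: "P \<in> \<Q>" "Q \<in> \<Q>" "A = graph_on (R P) (\<alpha> P)" "A' = graph_on (R Q) (\<alpha> Q)"
      using AA by (auto simp: \<A>_def)
    \<comment> \<open>\<open>small\<close> is stated for the spreadness \<open>v ^ (4 * t)\<close>
      of dense subcubes, and so covers the smaller \<open>v ^ (2 * t)\<close> of the pieces.\<close>
    have "n * v ^ (2 * t) \<le> n * v ^ (4 * t)" using v4 by (intro mult_left_mono) auto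
    then have "n * v ^ (2 * t) < \<eta> * m" using small by simp
    then show ?thesis unfolding PQ(3,4)
      using PQ(1,2) \<Q>\<P> R\<alpha> v \<eta> block_subset[OF l]
      by (intro agreement_of_alive_pieces[where \<Lambda> = "v ^ (2 * t)" and B = "block t l" and \<beta> = \<beta> and \<eta> = \<eta>])
        (auto simp: \<Q>_def)
  qed
  show ?thesis
  proof (cases "\<exists>T. card T = t \<and> finite T \<and> T \<subseteq> \<Inter>\<A>")
    case True
    then obtain T where T: "card T = t" "T \<subseteq> \<Inter>\<A>" by auto
    obtain P0 where P0: "P0 \<in> \<Q>" using \<open>\<Q> \<noteq> {}\<close> by auto
    have pP0: "piece (v ^ (2 * t)) P0 (R P0) (\<alpha> P0)" using P0 \<Q>\<P> R\<alpha> by auto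
    obtain x0 where x0: "x0 \<in> P0" using pieceD(2)[OF pP0] by auto
    define T' where "T' = fst ` T"
    define a where "a = restrict (\<alpha> P0) T'"
    have TP0: "T \<subseteq> graph_on (R P0) (\<alpha> P0)" using T P0 by (auto simp: \<A>_def)
    then have T'R: "T' \<subseteq> R P0" by (auto simp: T'_def graph_on_def)
    have Ta: "T = graph_on T' a" using TP0 by (force simp: T'_def graph_on_def a_def)
    then have cT': "card T' = t" using T card_graph_on by metis
    have T'n: "T' \<subseteq> {..<n}" using T'R pieceD(3)[OF pP0] by auto
    have a_bd: "a \<in> PiE T' (\<lambda>_. {..<m})"
    proof
      fix i assume i: "i \<in> T'"
      have "x0 \<in> cube m n" using x0 pieceD(1)[OF pP0] F_cube by auto
      then have "x0 i < m" using i T'n by (auto simp: cube_def PiE_iff)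
      moreover have "x0 i = \<alpha> P0 i" using i T'R pieceD(7)[OF pP0 x0] by auto
      ultimately show "a i \<in> {..<m}" using i by (simp add: a_def)
    qed (simp add: a_def)
    have "\<Union>\<Q> \<subseteq> fib F T' a"
    proof
      fix x assume "x \<in> \<Union>\<Q>"
      then obtain P where P: "P \<in> \<Q>" "x \<in> P" by auto
      have pP: "piece (v ^ (2 * t)) P (R P) (\<alpha> P)" using P \<Q>\<P> R\<alpha> by auto
      have "x i = a i" if i: "i \<in> T'" for i
      proof -
        have "(i, a i) \<in> T" using i by (subst Ta) (auto simp: graph_on_def)
        then have "(i, a i) \<in> graph_on (R P) (\<alpha> P)" using T P by (auto simp: \<A>_def)
        then show ?thesis using pieceD(7)[OF pP P(2)] by (auto simp: graph_on_def)
      qed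
      then show "x \<in> fib F T' a" using P UF by (auto simp: fib_def)
    qed
    then have "card (\<Union>\<Q>) \<le> card (fib F T' a)" by (intro card_mono finite_fib finite_F)
    then have "card (\<Union>\<Q>) * (real m ^ t * v ^ (3 * t)) \<le> card (fib F T' a) * (real m ^ t * v ^ (3 * t))"
      using v(1) by (intro mult_right_mono) auto
    then have "real m ^ n \<le> 8 * (card (fib F T' a) * (real m ^ t * v ^ (3 * t)))" using mass by linarith
    \<comment> \<open>The constant 8 is absorbed by one more \<open>v ^ t\<close>, which raises the
      exponent to \<open>4 * t\<close>.\<close>
    also have "\<dots> \<le> v ^ t * (card (fib F T' a) * (real m ^ t * v ^ (3 * t)))"
      using large(2) v(1) by (intro mult_right_mono) auto
    also have "\<dots> = card (fib F T' a) * (real m ^ t * (v ^ t * v ^ (3 * t)))" by (simp only: mult_ac)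
    also have "v ^ t * v ^ (3 * t) = v ^ (4 * t)" by (simp add: power_add[symmetric])
    finally show ?thesis using T'n cT' a_bd by blast
  next
    case False
    obtain \<C> where \<C>: "finite \<C>" "card \<C> \<le> 2 ^ q * q"
      "\<And>C. C \<in> \<C> \<Longrightarrow> finite C \<and> card C = t + 1 \<and> C \<subseteq> \<Union>\<A>" "\<And>A. A \<in> \<A> \<Longrightarrow> \<exists>C\<in>\<C>. C \<subseteq> A"
      using intersecting_core_or_cover[OF \<A>_ne \<A>_fin \<A>_int False] by auto
    define hits where "hits C = {x\<in>cube m n. \<forall>(i,a)\<in>C. x i = a}" for C :: "(nat \<times> nat) set"
    have "\<Union>\<Q> \<subseteq> (\<Union>C\<in>\<C>. hits C)"
    proof
      fix x assume "x \<in> \<Union>\<Q>"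
      then obtain P where P: "P \<in> \<Q>" "x \<in> P" by auto
      have pP: "piece (v ^ (2 * t)) P (R P) (\<alpha> P)" using P \<Q>\<P> R\<alpha> by auto
      obtain C where C: "C \<in> \<C>" "C \<subseteq> graph_on (R P) (\<alpha> P)"
        using \<C>(4)[of "graph_on (R P) (\<alpha> P)"] P by (auto simp: \<A>_def)
      have "x \<in> hits C"
        using C pieceD(7)[OF pP P(2)] P UF F_cube by (auto simp: hits_def graph_on_def)
      then show "x \<in> (\<Union>C\<in>\<C>. hits C)" using C by auto
    qed
    then have "card (\<Union>\<Q>) \<le> card (\<Union>C\<in>\<C>. hits C)"
      using \<C>(1) by (intro card_mono) (auto simp: hits_def)
    also have "\<dots> \<le> (\<Sum>C\<in>\<C>. card (hits C))" by (intro card_UN_le \<C>)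
    finally have "card (\<Union>\<Q>) * m ^ (t + 1) \<le> (\<Sum>C\<in>\<C>. card (hits C)) * m ^ (t + 1)"
      by (rule mult_le_mono1)
    also have "\<dots> = (\<Sum>C\<in>\<C>. card (hits C) * m ^ card C)"
      using \<C>(3) by (simp add: sum_distrib_right)
    also have "\<dots> \<le> (\<Sum>C\<in>\<C>. m ^ n)"
    proof (rule sum_mono)
      fix C assume C: "C \<in> \<C>"
      have "fst ` C \<subseteq> {..<n}"
      proof
        fix i assume "i \<in> fst ` C"
        then obtain A where "A \<in> \<A>" "i \<in> fst ` A" using \<C>(3)[OF C] by blast
        then obtain P where "P \<in> \<Q>" "i \<in> R P" by (auto simp: \<A>_def graph_on_def)
        then show "i \<in> {..<n}" using pieceD(3)[of _ P "R P"] R\<alpha> \<Q>\<P> by blast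
      qed
      then show "card (hits C) * m ^ card C \<le> m ^ n"
        unfolding hits_def using \<C>(3)[OF C] by (intro card_hits_le) auto
    qed
    also have "\<dots> \<le> 2 ^ q * q * m ^ n" using \<C>(2) by simp
    finally have "real (card (\<Union>\<Q>) * m ^ (t + 1)) \<le> real (2 ^ q * q * m ^ n)" by (simp only: of_nat_le_iff)
    then have up: "card (\<Union>\<Q>) * (real m ^ t * real m) \<le> 2 ^ q * q * real m ^ n" by (simp add: mult_ac)
    \<comment> \<open>One more fixed coordinate gains \<open>m\<close>, of which
      \<open>v ^ (3 * t)\<close> is used up by \<open>mass\<close>; the remaining
      \<open>v ^ (5 * t)\<close> beats the number of covering subcubes, a contradiction.\<close>
    have "real m = v ^ (5 * t) * v ^ (3 * t)" by (simp add: v(2) power_add[symmetric])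
    then have "v ^ (5 * t) * real m ^ n < 8 * (card (\<Union>\<Q>) * (real m ^ t * real m))"
      using mass v(1) mult_strict_left_mono[OF mass, of "v ^ (5 * t)"] by (simp add: mult_ac)
    also have "\<dots> \<le> 8 * (2 ^ q * q * real m ^ n)" using up by simp
    also have "\<dots> = 8 * (2 ^ q * q) * real m ^ n" by simp
    also have "\<dots> \<le> v ^ (5 * t) * real m ^ n" using large(1) by (intro mult_right_mono) auto
    finally show ?thesis by simp
  qed
qed

section \<open>Density in a subcube as a product over blocks\<close>

lemma card_product_le:
  assumes T: "T \<subseteq> {..<n}" and L: "finite L" "\<And>l. l \<in> L \<Longrightarrow> l < n div t \<and> block t l \<inter> T = {}"
    and A: "\<And>l. l \<in> L \<Longrightarrow> finite (A l)"
  shows "card {x\<in>fib (cube m n) T a. \<forall>l\<in>L. restrict x (block t l) \<in> A l} * (m ^ card T * (m ^ t) ^ card L)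
    \<le> m ^ n * (\<Prod>l\<in>L. card (A l))"
proof -
  let ?X = "{x\<in>fib (cube m n) T a. \<forall>l\<in>L. restrict x (block t l) \<in> A l}"
  define U where "U = T \<union> (\<Union>l\<in>L. block t l)"
  have fT: "finite T" using T finite_subset by blast
  have Un: "U \<subseteq> {..<n}" using T L(2) block_subset by (fastforce simp: U_def)
  have cU: "card U = card T + t * card L"
  proof -
    have "card (\<Union>l\<in>L. block t l) = (\<Sum>l\<in>L. card (block t l))"
      using disjoint_block by (intro card_UN_disjoint L) auto
    then show ?thesis unfolding U_def using L fT by (subst card_Un_disjoint) auto
  qed
  let ?f = "\<lambda>x. (\<lambda>l\<in>L. restrict x (block t l), restrict x ({..<n} - U))"
  let ?Y = "PiE L A \<times> PiE ({..<n} - U) (\<lambda>_. {..<m})"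
  have "card ?X \<le> card ?Y"
  proof (rule card_inj_on_le[where f = ?f])
    show "inj_on ?f ?X"
    proof (rule inj_onI)
      fix x y assume x: "x \<in> ?X" and y: "y \<in> ?X" and e: "?f x = ?f y"
      show "x = y"
      proof (rule PiE_ext)
        show "x \<in> PiE {..<n} (\<lambda>_. {..<m})" "y \<in> PiE {..<n} (\<lambda>_. {..<m})"
          using x y by (auto simp: fib_def cube_def)
        fix i assume i: "i \<in> {..<n}"
        consider "i \<in> T" | l where "l \<in> L" "i \<in> block t l" | "i \<notin> U" by (auto simp: U_def)
        then show "x i = y i"
        proof cases
          case 1 then show ?thesis using x y by (auto simp: fib_def)
        next
          case (2 l)
          have "(\<lambda>l\<in>L. restrict x (block t l)) l = (\<lambda>l\<in>L. restrict y (block t l)) l" using e by simp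
          then have "restrict x (block t l) i = restrict y (block t l) i" using 2 by simp
          then show ?thesis using 2 by simp
        next
          case 3
          have "restrict x ({..<n} - U) i = restrict y ({..<n} - U) i" using e by simp
          then show ?thesis using 3 i by simp
        qed
      qed
    qed
    show "?f ` ?X \<subseteq> ?Y" by (auto simp: fib_def cube_def)
    show "finite ?Y" using L A by (intro finite_cartesian_product finite_PiE) auto
  qed
  also have "card ?Y = (\<Prod>l\<in>L. card (A l)) * m ^ (n - card U)"
    using L Un by (simp add: card_cartesian_product card_PiE card_Diff_subset finite_subset)
  finally have "card ?X * m ^ card U \<le> (\<Prod>l\<in>L. card (A l)) * m ^ (n - card U) * m ^ card U"
    by (rule mult_le_mono1)
  also have "\<dots> = (\<Prod>l\<in>L. card (A l)) * m ^ n"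
    using card_mono[OF _ Un] by (simp add: mult.assoc flip: power_add)
  finally show ?thesis by (simp add: cU power_add power_mult mult_ac)
qed

text \<open>Density gives spreadness for free: fixing \<open>S\<close> as well leaves at most
  \<open>m ^ n / m ^ (t + card S)\<close> points of the cube, and the family holds a fraction of at
  least \<open>1 / \<Lambda>\<close> of \<open>m ^ n / m ^ t\<close>.\<close>

lemma dense_piece:
  fixes \<Lambda> :: real
  assumes T: "T \<subseteq> {..<n}" "card T = t"
    and dense: "real m ^ n \<le> card (fib F T a) * (real m ^ t * \<Lambda>)"
  shows "piece \<Lambda> (fib F T a) T a"
proof -
  have m0: "0 < real m" using m_pos by simp
  have "0 < real m ^ n" using m0 by simp
  then have pos: "0 < card (fib F T a) * (real m ^ t * \<Lambda>)" using dense by linarith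
  then have \<Lambda>: "0 < \<Lambda>" using m0 by (simp add: zero_less_mult_iff)
  have ne: "fib F T a \<noteq> {}"
  proof
    assume "fib F T a = {}"
    then show False using pos by simp
  qed
  show ?thesis
    unfolding piece_def
  proof (intro conjI allI impI)
    show "fib F T a \<subseteq> F" by (rule fib_subset)
    show "\<forall>x\<in>fib F T a. \<forall>i\<in>T. x i = a i" by (auto simp: fib_def)
    fix S c assume S: "S \<subseteq> {..<n} - T" "card S \<le> t"
    have fS: "finite S" "finite T" using S T finite_subset by (blast, blast)
    let ?G = "fib (fib F T a) S c"
    show "real (card ?G) * real m ^ card S \<le> \<Lambda> * real (card (fib F T a))"
    proof (cases "?G = {}")
      case True
      then show ?thesis using \<Lambda> by simp
    next
      case False
      then obtain x where x: "x \<in> ?G" by auto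
      have "?G \<subseteq> fib (cube m n) (T \<union> S) x" using x F_cube by (auto simp: fib_def)
      then have "card ?G \<le> card (fib (cube m n) (T \<union> S) x)" by (intro card_mono finite_fib finite_cube)
      moreover have "T \<union> S \<subseteq> {..<n}" using T S by auto
      ultimately have "card ?G * m ^ card (T \<union> S) \<le> m ^ n"
        by (rule le_trans[OF mult_le_mono1 card_fib_cube_le])
      also have "card (T \<union> S) = t + card S"
        using S fS T by (subst card_Un_disjoint) auto
      finally have "real (card ?G * m ^ (t + card S)) \<le> real (m ^ n)" by (simp only: of_nat_le_iff)
      also have "\<dots> \<le> card (fib F T a) * (real m ^ t * \<Lambda>)" using dense by simp
      finally have "(card ?G * real m ^ card S) * real m ^ t \<le> (\<Lambda> * card (fib F T a)) * real m ^ t"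
        by (simp add: power_add mult_ac)
      then show ?thesis using m0 by simp
    qed
  qed (use T ne in auto)
qed

text \<open>Points with a non-alive restriction in some block of \<open>L\<close> make up at most
  half of \<open>P\<close>, whence the factor 2. The others lie in a product set, counted by
  \<open>card_product_le\<close>.\<close>

lemma card_piece_le_prod:
  fixes \<Lambda> \<eta> :: real
  assumes P: "piece \<Lambda> P R \<alpha>" and \<eta>: "0 \<le> \<eta>" "n * (2 ^ t * \<eta>) \<le> 1 / 2"
    and L: "\<And>l. l \<in> L \<Longrightarrow> l < n div t \<and> block t l \<inter> R = {}"
  shows "card P * real m ^ card R \<le> 2 * real m ^ n * (\<Prod>l\<in>L. card (alive \<eta> P (block t l)) / real m ^ t)"
proof -
  have m0: "0 < real m" using m_pos by simp
  have Lb: "L \<subseteq> {..<n div t}" using L by auto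
  then have fL: "finite L" using finite_subset by blast
  have "card L \<le> n div t" using card_mono[OF _ Lb] by simp
  then have cL: "card L \<le> n" using div_le_dividend le_trans by blast
  have fP: "finite P" by (rule pieceD(4)[OF P])
  let ?A = "\<lambda>l. alive \<eta> P (block t l)"
  define G where "G = {x\<in>P. \<forall>l\<in>L. restrict x (block t l) \<in> ?A l}"
  have "P \<subseteq> G \<union> (\<Union>l\<in>L. {x\<in>P. restrict x (block t l) \<notin> ?A l})" by (auto simp: G_def)
  then have "card P \<le> card (G \<union> (\<Union>l\<in>L. {x\<in>P. restrict x (block t l) \<notin> ?A l}))"
    using fP fL by (intro card_mono) (auto simp: G_def)
  also have "\<dots> \<le> card G + card (\<Union>l\<in>L. {x\<in>P. restrict x (block t l) \<notin> ?A l})" by (rule card_Un_le)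
  also have "\<dots> \<le> card G + (\<Sum>l\<in>L. card {x\<in>P. restrict x (block t l) \<notin> ?A l})"
    by (intro add_left_mono card_UN_le fL)
  finally have "real (card P) \<le> card G + (\<Sum>l\<in>L. real (card {x\<in>P. restrict x (block t l) \<notin> ?A l}))"
    by (simp only: of_nat_sum[symmetric] of_nat_add[symmetric] of_nat_le_iff)
  also have "\<dots> \<le> card G + (\<Sum>l\<in>L. 2 ^ t * \<eta> * card P)"
    using L block_subset[of _ n t] \<eta>
    by (intro add_left_mono sum_mono card_non_alive[OF pieceD(1)[OF P]]) auto
  also have "\<dots> = card G + card L * (2 ^ t * \<eta>) * card P" by simp
  also have "\<dots> \<le> card G + n * (2 ^ t * \<eta>) * card P"
    using cL \<eta> by (intro add_left_mono mult_right_mono) auto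
  also have "\<dots> \<le> card G + 1 / 2 * card P"
    by (intro add_left_mono mult_right_mono \<eta>) auto
  finally have half: "real (card P) \<le> 2 * card G" by simp
  have "G \<subseteq> {x\<in>fib (cube m n) R \<alpha>. \<forall>l\<in>L. restrict x (block t l) \<in> ?A l}"
    using pieceD(1,7)[OF P] F_cube by (auto simp: G_def fib_def)
  then have "card G \<le> card {x\<in>fib (cube m n) R \<alpha>. \<forall>l\<in>L. restrict x (block t l) \<in> ?A l}"
    by (rule card_mono[rotated]) (simp add: finite_fib)
  then have "card G * (m ^ card R * (m ^ t) ^ card L) \<le> m ^ n * (\<Prod>l\<in>L. card (?A l))"
    using card_product_le[OF pieceD(3)[OF P] fL L, of ?A \<alpha>] finite_alive
    by (meson finite_block le_trans mult_le_mono1)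
  then have "real (card G * (m ^ card R * (m ^ t) ^ card L)) \<le> real (m ^ n * (\<Prod>l\<in>L. card (?A l)))"
    by (simp only: of_nat_le_iff)
  then have "(card G * real m ^ card R) * (real m ^ t) ^ card L \<le> real m ^ n * (\<Prod>l\<in>L. real (card (?A l)))"
    by (simp add: mult_ac)
  then have "card G * real m ^ card R \<le> real m ^ n * ((\<Prod>l\<in>L. real (card (?A l))) / (real m ^ t) ^ card L)"
    using m0 by (simp add: field_simps)
  also have "(\<Prod>l\<in>L. real (card (?A l))) / (real m ^ t) ^ card L = (\<Prod>l\<in>L. card (?A l) / real m ^ t)"
    by (simp add: prod_dividef)
  finally have "card G * real m ^ card R \<le> real m ^ n * (\<Prod>l\<in>L. card (?A l) / real m ^ t)" .
  moreover have "card P * real m ^ card R \<le> 2 * card G * real m ^ card R"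
    using half by (intro mult_right_mono) auto
  ultimately show ?thesis by simp
qed

section \<open>Comparison of distinct dense subcubes\<close>

lemma graph_on_inter_eq:
  assumes "finite T" "card T = t" "card T' = t" "finite T'"
    "a \<in> extensional T" "a' \<in> extensional T'"
    and "t \<le> card (graph_on T a \<inter> graph_on T' a')"
  shows "T = T' \<and> a = a'"
proof -
  have f: "finite (graph_on T a)" "finite (graph_on T' a')" using assms by (auto simp: graph_on_def)
  have "graph_on T a \<inter> graph_on T' a' = graph_on T a" "graph_on T a \<inter> graph_on T' a' = graph_on T' a'"
    using assms f by (intro card_seteq; simp add: card_graph_on)+
  then have eq: "graph_on T a = graph_on T' a'" by simp
  have "T = fst ` graph_on T a" "T' = fst ` graph_on T' a'" by (auto simp: graph_on_def image_iff)
  then have T: "T = T'" using eq by simp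
  moreover have "a = a'"
  proof (rule extensionalityI[of _ T])
    fix i assume "i \<in> T"
    then have "(i, a i) \<in> graph_on T' a'" using eq by (auto simp: graph_on_def)
    then show "a i = a' i" by (auto simp: graph_on_def)
  qed (use assms T in auto)
  ultimately show ?thesis by simp
qed

text \<open>The points in no dense subcube account for \<open>1 / v ^ t\<close>. The dense subcube
  with the largest product \<open>\<pi> d\<close> becomes \<open>D\<close>, and all others together
  account for \<open>2 * b * s\<close>; \<open>s\<close> is scaled so that \<open>s ^ 4\<close>
  bounds the product of two distinct \<open>\<pi> d\<close>.\<close>

lemma near_subcube:
  fixes v \<eta> s :: real
  assumes v: "1 < v" "real m = v ^ (8 * t)"
    and \<eta>: "0 < \<eta>" "n * (2 ^ t * \<eta>) \<le> 1 / 2" and small: "n * v ^ (4 * t) < \<eta> * m"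
    and q: "q = 4 * t * (t + 1)" "2 * q \<le> n div t"
    and large: "8 * (2 ^ q * q) \<le> v ^ (5 * t)" "8 \<le> v ^ t"
    and b: "b = n div t" "t + 2 \<le> b" and s: "s = (1 / 2) ^ ((b - 2 * t) div 2)"
  shows "\<exists>D. is_subcube_codim m n t D \<and>
    card (F - D) * real m ^ t \<le> real m ^ n * (1 / v ^ t + 2 * real b * s)"
proof -
  have m0: "0 < real m" using m_pos by simp
  have \<eta>1: "2 ^ t * \<eta> \<le> 1 / 2"
  proof -
    have "1 * (2 ^ t * \<eta>) \<le> n * (2 ^ t * \<eta>)" using n_pos \<eta>(1) by (intro mult_right_mono) auto
    with \<eta>(2) show ?thesis by (simp only: mult_1_left)
  qed
  have tn: "t \<le> n"
  proof -
    have "1 \<le> n div t" using b by simp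
    then show ?thesis by (metis div_less not_le not_one_le_zero)
  qed
  define P where "P d = fib F (fst d) (snd d)" for d
  define \<D> where "\<D> = {d. fst d \<subseteq> {..<n} \<and> card (fst d) = t \<and> snd d \<in> PiE (fst d) (\<lambda>_. {..<m}) \<and>
    real m ^ n \<le> card (P d) * (real m ^ t * v ^ (4 * t))}"
  have fD: "finite \<D>"
  proof (rule finite_subset)
    show "\<D> \<subseteq> (SIGMA T:Pow {..<n}. PiE T (\<lambda>_. {..<m}))" by (auto simp: \<D>_def)
    show "finite (SIGMA T:Pow {..<n}. PiE T (\<lambda>_. {..<m}))"
      using finite_subset by (intro finite_SigmaI finite_PiE) auto
  qed
  define F0 where "F0 = F - (\<Union>d\<in>\<D>. P d)"
  \<comment> \<open>\<open>F0\<close> is again avoiding. Were it large, it would be dense in some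
    subcube, where \<open>F\<close> is then dense too; but the points of \<open>F\<close> in such
    subcubes have been removed.\<close>
  have F0: "card F0 * (real m ^ t * v ^ t) \<le> real m ^ n"
  proof (rule ccontr)
    assume "\<not> ?thesis"
    then have gt: "real m ^ n < card F0 * (real m ^ t * v ^ t)" by simp
    interpret F0: avoiding_family m n t F0
      using F_cube avoid t_pos m_pos n_pos by unfold_locales (auto simp: F0_def avoiding_def)
    obtain T a where Ta: "T \<subseteq> {..<n}" "card T = t" "a \<in> PiE T (\<lambda>_. {..<m})"
      "real m ^ n \<le> card (fib F0 T a) * (real m ^ t * v ^ (4 * t))"
      using F0.ex_dense_subcube[OF v \<eta>(1) \<eta>1 small q large gt] by auto
    have "card (fib F0 T a) \<le> card (fib F T a)"
      by (intro card_mono fib_mono finite_fib finite_F) (auto simp: F0_def)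
    then have "card (fib F0 T a) * (real m ^ t * v ^ (4 * t)) \<le> card (fib F T a) * (real m ^ t * v ^ (4 * t))"
      using v(1) by (intro mult_right_mono) auto
    then have "(T, a) \<in> \<D>" using Ta by (simp add: \<D>_def P_def)
    then have "fib F T a \<subseteq> (\<Union>d\<in>\<D>. P d)" by (force simp: P_def)
    then have "fib F0 T a = {}" by (auto simp: F0_def fib_def)
    then have "real m ^ n \<le> 0" using Ta(4) by simp
    moreover have "0 < real m ^ n" using m0 by simp
    ultimately show False by linarith
  qed
  define L where "L d = {l. l < b \<and> block t l \<inter> fst d = {}}" for d :: "nat set \<times> (nat \<Rightarrow> nat)"
  define p where "p d l = card (alive \<eta> (P d) (block t l)) / real m ^ t" for d l
  define \<pi> where "\<pi> d = (\<Prod>l\<in>L d. p d l)" for d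
  have fL: "finite (L d)" for d by (simp add: L_def)
  have p01: "0 \<le> p d l \<and> p d l \<le> 1" for d l
  proof -
    have "real (card (alive \<eta> (P d) (block t l))) \<le> real (m ^ t)"
      using card_alive_le[of "block t l" \<eta> "P d"] by (simp only: of_nat_le_iff card_block finite_block)
    then show ?thesis using m0 by (simp add: p_def)
  qed
  have \<pi>0: "0 \<le> \<pi> d" for d unfolding \<pi>_def using p01 by (intro prod_nonneg) auto
  have pieceD\<D>: "piece (v ^ (4 * t)) (P d) (fst d) (snd d)" if "d \<in> \<D>" for d
    using that unfolding P_def by (intro dense_piece) (auto simp: \<D>_def P_def)
  have size: "card (P d) * real m ^ t \<le> 2 * real m ^ n * \<pi> d" if d: "d \<in> \<D>" for d
    using card_piece_le_prod[OF pieceD\<D>[OF d] _ \<eta>(2), of "L d"] \<eta>(1) d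
    by (auto simp: \<pi>_def p_def L_def b \<D>_def)
  \<comment> \<open>A common alive restriction would force \<open>t\<close> shared constraints, and
    as each subcube has exactly \<open>t\<close>, the two would coincide.\<close>
  have disj: "alive \<eta> (P d) (block t l) \<inter> alive \<eta> (P d') (block t l) = {}"
    if d: "d \<in> \<D>" "d' \<in> \<D>" "d \<noteq> d'" "l \<in> L d" "l \<in> L d'" for d d' l
  proof (rule ccontr)
    assume "\<not> ?thesis"
    then obtain \<beta> where \<beta>: "\<beta> \<in> alive \<eta> (P d) (block t l)" "\<beta> \<in> alive \<eta> (P d') (block t l)" by auto
    have "t \<le> card (graph_on (fst d) (snd d) \<inter> graph_on (fst d') (snd d'))"
      using d v(1) block_subset[of l n t]
      by (intro agreement_of_alive_pieces[OF pieceD\<D>[OF d(1)] pieceD\<D>[OF d(2)] \<eta>(1) _ small _ _ _ _ \<beta>])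
        (auto simp: L_def b)
    then have "fst d = fst d' \<and> snd d = snd d'"
      using d(1,2) finite_subset[of _ "{..<n}"]
      by (intro graph_on_inter_eq) (auto simp: \<D>_def PiE_iff)
    then show False using d(3) by (simp add: prod_eq_iff)
  qed
  have sum_p: "(\<Sum>d\<in>{d\<in>\<D>. l \<in> L d}. p d l) \<le> 1" for l
  proof -
    let ?E = "{d\<in>\<D>. l \<in> L d}"
    have "(\<Sum>d\<in>?E. card (alive \<eta> (P d) (block t l))) = card (\<Union>d\<in>?E. alive \<eta> (P d) (block t l))"
      using fD disj finite_alive by (intro card_UN_disjoint[symmetric]) auto
    also have "\<dots> \<le> card (PiE (block t l) (\<lambda>_. {..<m}))"
      by (intro card_mono finite_PiE) (auto simp: alive_def)
    also have "\<dots> = m ^ t" by (simp add: card_PiE)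
    finally have "real (\<Sum>d\<in>?E. card (alive \<eta> (P d) (block t l))) \<le> real (m ^ t)" by (simp only: of_nat_le_iff)
    then show ?thesis using m0 by (simp add: p_def sum_divide_distrib[symmetric])
  qed
  have cards: "b \<le> card (L d \<inter> L d') + 2 * t" if d: "d \<in> \<D>" "d' \<in> \<D>" for d d'
  proof -
    let ?U = "fst d \<union> fst d'"
    have fU: "finite ?U" using d finite_subset[of _ "{..<n}"] by (auto simp: \<D>_def)
    have "card ?U \<le> 2 * t" using card_Un_le[of "fst d" "fst d'"] d by (auto simp: \<D>_def)
    then have meet: "card {l. l < b \<and> block t l \<inter> ?U \<noteq> {}} \<le> 2 * t"
      using card_blocks_meeting[OF fU] le_trans by blast
    have "{..<b} \<subseteq> (L d \<inter> L d') \<union> {l. l < b \<and> block t l \<inter> ?U \<noteq> {}}" by (auto simp: L_def)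
    then have "card {..<b} \<le> card ((L d \<inter> L d') \<union> {l. l < b \<and> block t l \<inter> ?U \<noteq> {}})"
      by (intro card_mono) (auto simp: L_def)
    also have "\<dots> \<le> card (L d \<inter> L d') + card {l. l < b \<and> block t l \<inter> ?U \<noteq> {}}"
      by (rule card_Un_le)
    finally have "b \<le> card (L d \<inter> L d') + card {l. l < b \<and> block t l \<inter> ?U \<noteq> {}}" by simp
    then show ?thesis using meet by linarith
  qed
  have card_L: "b \<le> card (L d) + t" if d: "d \<in> \<D>" for d
  proof -
    have fT: "finite (fst d)" using d finite_subset[of _ "{..<n}"] by (auto simp: \<D>_def)
    have meet: "card {l. l < b \<and> block t l \<inter> fst d \<noteq> {}} \<le> t"
      using card_blocks_meeting[OF fT] d by (auto simp: \<D>_def)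
    have "{..<b} \<subseteq> L d \<union> {l. l < b \<and> block t l \<inter> fst d \<noteq> {}}" by (auto simp: L_def)
    then have "card {..<b} \<le> card (L d \<union> {l. l < b \<and> block t l \<inter> fst d \<noteq> {}})"
      by (intro card_mono) (auto simp: L_def)
    also have "\<dots> \<le> card (L d) + card {l. l < b \<and> block t l \<inter> fst d \<noteq> {}}"
      by (rule card_Un_le)
    finally have "b \<le> card (L d) + card {l. l < b \<and> block t l \<inter> fst d \<noteq> {}}" by simp
    then show ?thesis using meet by linarith
  qed
  have s0: "0 \<le> s" by (simp add: s)
  \<comment> \<open>In each of the at least \<open>b - 2 * t\<close> blocks free for both, two
    densities with sum at most 1 have product at most 1/4.\<close>
  have pair: "\<pi> d * \<pi> d' \<le> (s\<^sup>2)\<^sup>2" if d: "d \<in> \<D>" "d' \<in> \<D>" "d \<noteq> d'" for d d'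
  proof -
    let ?K = "L d \<inter> L d'"
    have "\<pi> d * \<pi> d' \<le> (\<Prod>l\<in>?K. p d l) * (\<Prod>l\<in>?K. p d' l)"
      unfolding \<pi>_def using p01 fL
      by (intro mult_mono prod_le_prod_subset prod_nonneg) auto
    also have "\<dots> = (\<Prod>l\<in>?K. p d l * p d' l)" by (rule prod.distrib[symmetric])
    also have "\<dots> \<le> (\<Prod>l\<in>?K. 1 / 4)"
    proof (rule prod_mono)
      fix l assume l: "l \<in> ?K"
      have "(\<Sum>e\<in>{d, d'}. p e l) \<le> (\<Sum>d\<in>{d\<in>\<D>. l \<in> L d}. p d l)"
        using fD d l p01 by (intro sum_mono2) auto
      then have "p d l + p d' l \<le> 1" using d(3) sum_p[of l] by simp
      then have "p d l * p d' l \<le> p d l * (1 - p d l)" using p01 by (intro mult_left_mono) auto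
      also have "\<dots> = 1 / 4 - (p d l - 1 / 2)\<^sup>2" by (simp add: power2_eq_square algebra_simps)
      also have "\<dots> \<le> 1 / 4" by simp
      finally show "0 \<le> p d l * p d' l \<and> p d l * p d' l \<le> 1 / 4" using p01 by simp
    qed
    also have "\<dots> = (1 / 4 :: real) ^ card ?K" by simp
    also have "\<dots> \<le> (1 / 4) ^ (2 * ((b - 2 * t) div 2))"
      using cards[OF d(1,2)] by (intro power_decreasing) auto
    also have "\<dots> = (s\<^sup>2)\<^sup>2"
    proof -
      have "(1 / 4 :: real) = (1 / 2)\<^sup>2" by (simp add: power2_eq_square)
      then show ?thesis unfolding s by (simp only: power_mult[symmetric]) (simp add: mult_ac)
    qed
    finally show ?thesis .
  qed
  \<comment> \<open>Two factors of the product are kept, which takes two free blocks and hence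
    \<open>t + 2 \<le> b\<close>.\<close>
  have sq: "\<pi> d \<le> (\<Sum>l\<in>L d. p d l)\<^sup>2" if d: "d \<in> \<D>" for d
  proof -
    have "2 \<le> card (L d)" using card_L[OF d] b by simp
    then obtain K where K: "K \<subseteq> L d" "card K = 2" by (metis obtain_subset_with_card_n)
    then obtain l l' where l: "K = {l, l'}" "l \<noteq> l'" by (auto simp: card_2_iff)
    have "\<pi> d \<le> prod (p d) K" unfolding \<pi>_def using K p01 fL by (intro prod_le_prod_subset) auto
    also have "\<dots> = p d l * p d l'" using l by simp
    also have "\<dots> \<le> (\<Sum>l\<in>L d. p d l) * (\<Sum>l\<in>L d. p d l)"
      using K l p01 fL by (intro mult_mono member_le_sum sum_nonneg) auto
    finally show ?thesis by (simp add: power2_eq_square)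
  qed
  obtain T0 a0 where Ta0: "T0 \<subseteq> {..<n}" "card T0 = t" "a0 \<in> PiE T0 (\<lambda>_. {..<m})"
    "\<And>d. d \<in> \<D> \<Longrightarrow> d \<noteq> (T0, a0) \<Longrightarrow> \<pi> d \<le> s\<^sup>2"
  proof (cases "\<D> = {}")
    case True
    \<comment> \<open>Without dense subcubes an arbitrary subcube of co-dimension \<open>t\<close>
      serves.\<close>
    have "{..<t} \<subseteq> {..<n}" "card {..<t} = t" "restrict (\<lambda>_. 0) {..<t} \<in> PiE {..<t} (\<lambda>_. {..<m})"
      using tn m_pos by auto
    then show ?thesis using that True by blast
  next
    case False
    then have "Max (\<pi> ` \<D>) \<in> \<pi> ` \<D>" using fD by (intro Max_in) auto
    then obtain d0 where d0: "d0 \<in> \<D>" "\<pi> d0 = Max (\<pi> ` \<D>)" by auto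
    \<comment> \<open>Maximality of \<open>d0\<close> turns the bound for pairs into one for
      \<open>d\<close> alone: the square of \<open>\<pi> d\<close> is at most
      \<open>\<pi> d * \<pi> d0\<close>.\<close>
    have "\<pi> d \<le> s\<^sup>2" if d: "d \<in> \<D>" "d \<noteq> d0" for d
    proof -
      have "\<pi> d \<le> \<pi> d0" unfolding d0(2) using fD d by (intro Max_ge) auto
      then have "(\<pi> d)\<^sup>2 \<le> \<pi> d * \<pi> d0"
        using \<pi>0 by (simp add: power2_eq_square mult_left_mono)
      also have "\<dots> \<le> (s\<^sup>2)\<^sup>2" by (rule pair) (use d d0 in auto)
      finally show ?thesis by (rule power2_le_imp_le) simp
    qed
    then show ?thesis using that[of "fst d0" "snd d0"] d0 by (auto simp: \<D>_def)
  qed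
  define E where "E = \<D> - {(T0, a0)}"
  \<comment> \<open>Geometric mean of \<open>Ta0(4)\<close> and \<open>sq\<close>: the factor
    \<open>s\<close> is small, and the sum can be summed over \<open>d\<close> because the densities
    in one block total at most 1. So the number of dense subcubes never enters.\<close>
  have "\<pi> d \<le> s * (\<Sum>l\<in>L d. p d l)" if d: "d \<in> E" for d
  proof (rule power2_le_imp_le)
    have "(\<pi> d)\<^sup>2 \<le> s\<^sup>2 * (\<Sum>l\<in>L d. p d l)\<^sup>2"
      using d Ta0(4)[of d] sq[of d] \<pi>0 unfolding power2_eq_square[of "\<pi> d"]
      by (intro mult_mono) (auto simp: E_def)
    then show "(\<pi> d)\<^sup>2 \<le> (s * (\<Sum>l\<in>L d. p d l))\<^sup>2" by (simp add: power_mult_distrib)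
    show "0 \<le> s * (\<Sum>l\<in>L d. p d l)" using s0 p01 by (intro mult_nonneg_nonneg sum_nonneg) auto
  qed
  then have "(\<Sum>d\<in>E. \<pi> d) \<le> (\<Sum>d\<in>E. s * (\<Sum>l\<in>L d. p d l))" by (rule sum_mono)
  also have "\<dots> = s * (\<Sum>d\<in>E. \<Sum>l\<in>{l\<in>{..<b}. l \<in> L d}. p d l)"
    by (simp add: sum_distrib_left[symmetric]) (auto intro!: sum.cong arg_cong2[where f = "(*)"] simp: L_def)
  also have "(\<Sum>d\<in>E. \<Sum>l\<in>{l\<in>{..<b}. l \<in> L d}. p d l) = (\<Sum>l<b. \<Sum>d\<in>{d\<in>E. l \<in> L d}. p d l)"
    by (rule sum.swap_restrict) (use fD in \<open>auto simp: E_def\<close>)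
  also have "\<dots> \<le> (\<Sum>l<b. 1)"
  proof (rule sum_mono)
    fix l
    have "(\<Sum>d\<in>{d\<in>E. l \<in> L d}. p d l) \<le> (\<Sum>d\<in>{d\<in>\<D>. l \<in> L d}. p d l)"
      using fD p01 by (intro sum_mono2) (auto simp: E_def)
    then show "(\<Sum>d\<in>{d\<in>E. l \<in> L d}. p d l) \<le> 1" using sum_p[of l] by linarith
  qed
  finally have sum_\<pi>: "(\<Sum>d\<in>E. \<pi> d) \<le> s * b" using s0 by (simp add: mult_left_mono)
  define D where "D = subcube m n T0 a0"
  have "F - D \<subseteq> F0 \<union> (\<Union>d\<in>E. P d)"
  proof
    fix x assume x: "x \<in> F - D"
    then have "x \<notin> P (T0, a0)" using F_cube by (auto simp: D_def subcube_def P_def fib_def)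
    then show "x \<in> F0 \<union> (\<Union>d\<in>E. P d)" using x unfolding F0_def E_def by blast
  qed
  then have "card (F - D) \<le> card (F0 \<union> (\<Union>d\<in>E. P d))"
    using finite_F fD by (intro card_mono) (auto simp: F0_def E_def P_def intro: finite_fib)
  also have "\<dots> \<le> card F0 + card (\<Union>d\<in>E. P d)" by (rule card_Un_le)
  also have "\<dots> \<le> card F0 + (\<Sum>d\<in>E. card (P d))"
    using fD by (intro add_left_mono card_UN_le) (auto simp: E_def)
  finally have "real (card (F - D)) \<le> card F0 + (\<Sum>d\<in>E. real (card (P d)))"
    by (simp only: of_nat_sum[symmetric] of_nat_add[symmetric] of_nat_le_iff)
  then have "card (F - D) * real m ^ t \<le> (card F0 + (\<Sum>d\<in>E. real (card (P d)))) * real m ^ t"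
    by (intro mult_right_mono) auto
  also have "\<dots> = card F0 * real m ^ t + (\<Sum>d\<in>E. card (P d) * real m ^ t)"
    by (simp add: distrib_right sum_distrib_right)
  also have "(\<Sum>d\<in>E. card (P d) * real m ^ t) \<le> (\<Sum>d\<in>E. 2 * real m ^ n * \<pi> d)"
    using size by (intro sum_mono) (auto simp: E_def)
  also have "\<dots> = 2 * real m ^ n * (\<Sum>d\<in>E. \<pi> d)" by (simp add: sum_distrib_left)
  also have "\<dots> \<le> 2 * real m ^ n * (s * b)" using sum_\<pi> by (intro mult_left_mono) auto
  also have "card F0 * real m ^ t \<le> real m ^ n * (1 / v ^ t)"
    using F0 v(1) by (simp add: field_simps)
  finally have bound: "card (F - D) * real m ^ t \<le> real m ^ n * (1 / v ^ t + 2 * real b * s)"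
    by (simp add: algebra_simps)
  have "is_subcube_codim m n t D"
    unfolding is_subcube_codim_def D_def using Ta0 by (intro exI[of _ T0] exI[of _ a0]) (auto simp: PiE_iff)
  with bound show ?thesis by (intro exI[of _ D] conjI)
qed

end

section \<open>Choice of the constants\<close>

lemma eventually_le_exp:
  fixes c C :: real
  assumes "0 < c" "0 < C"
  shows "eventually (\<lambda>n::nat. C * real n ^ 2 \<le> 2 powr (c * real n)) at_top"
  using assms by real_asymp

theorem theorem7p14:
  fixes t N :: nat
  assumes "N \<ge> 1"
  shows "\<exists>K n0 :: nat. K \<ge> 1 \<and>
    (\<forall>m n :: nat. \<forall>F. F \<subseteq> cube m n \<longrightarrow> avoiding n (t - 1) F \<longrightarrow> n \<ge> n0 \<longrightarrow>
        real m \<ge> 2 powr (real n / real N) \<longrightarrow>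
        (\<exists>D. is_subcube_codim m n t D \<and>
             mu m n (F - D) \<le> 2 powr (- real n / real K) * real m powr (- real t)))"
proof (cases "t = 0")
  case True
  \<comment> \<open>In co-dimension 0 the whole cube is a subcube, and nothing of \<open>F\<close>
    remains outside it.\<close>
  have "is_subcube_codim m n 0 (cube m n)" for m n
    unfolding is_subcube_codim_def subcube_def by (intro exI[of _ "{}"]) auto
  moreover have "mu m n (F - cube m n) = 0" for m n F
    by (simp add: mu_def Diff_Int_distrib2)
  ultimately show ?thesis
    unfolding True by (intro exI[of _ 1] exI[of _ 0]) (fastforce intro!: exI[of _ "cube _ _"])
next
  case False
  then have t: "1 \<le> t" by simp
  define q where "q = 4 * t * (t + 1)"
  \<comment> \<open>\<open>C\<close> adds up what has to be dominated:
    \<open>8 * (2 ^ q * q)\<close> and 8 for the largeness conditions, and the powers of two that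
    multiply \<open>n\<^sup>2\<close>.\<close>
  define C :: real where "C = 8 * ((2::real) ^ q * real q) + 2 ^ (t + 4) + 8"
  \<comment> \<open>The eighth matches \<open>v ^ t = m powr (1 / 8)\<close>, so that
    \<open>2 powr (c1 * n) \<le> v ^ t\<close>. The decay rate of \<open>s\<close> is
    \<open>2 * c2\<close>, half of which pays for polynomial factors.\<close>
  define c1 where "c1 = 1 / (8 * real N)"
  define c2 where "c2 = 1 / (4 * real t)"
  have c: "0 < c1" "0 < c2" "0 < C" using assms t by (auto simp: c1_def c2_def C_def intro: add_nonneg_pos)
  have "eventually (\<lambda>n::nat. C * real n ^ 2 \<le> 2 powr (c1 * real n) \<and> C * real n ^ 2 \<le> 2 powr (c2 * real n)
    \<and> 1 \<le> n \<and> 16 * N \<le> n \<and> (2 * q + t + 2) * t \<le> n) at_top"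
    by (intro eventually_conj eventually_le_exp c eventually_ge_at_top)
  then obtain n0 where n0: "\<And>n. n \<ge> n0 \<Longrightarrow> C * real n ^ 2 \<le> 2 powr (c1 * real n) \<and>
    C * real n ^ 2 \<le> 2 powr (c2 * real n) \<and> 1 \<le> n \<and> 16 * N \<le> n \<and> (2 * q + t + 2) * t \<le> n"
    by (auto simp: eventually_at_top_linorder)
  show ?thesis
  \<comment> \<open>With this \<open>K\<close> the rate \<open>1 / K\<close> is at most
    \<open>c1 / 2\<close> and at most \<open>c2\<close>. The other half of \<open>c1 * n\<close> is
    at least 1 once \<open>16 * N \<le> n\<close>, which yields the factor 1/2 in
    \<open>x / 2\<close>.\<close>
  proof (rule exI[of _ "16 * N * t"], rule exI[of _ n0], intro conjI allI impI)
    show "1 \<le> 16 * N * t" using assms t by simp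
    fix m n :: nat and F
    assume F: "F \<subseteq> cube m n" "avoiding n (t - 1) F" and n: "n0 \<le> n"
      and m: "2 powr (real n / real N) \<le> real m"
    define y where "y = 2 powr (c1 * real n)"
    define x where "x = 2 powr (- real n / real (16 * N * t))"
    define b where "b = n div t"
    define s :: real where "s = (1 / 2) ^ ((b - 2 * t) div 2)"
    define v where "v = real m powr (1 / (8 * real t))"
    \<comment> \<open>The largest value with
      \<open>n * (2 ^ t * \<eta>) \<le> 1 / 2\<close>.\<close>
    define \<eta> :: real where "\<eta> = 1 / (2 ^ (t + 1) * n)"
    note N = n0[OF n]
    have n1: "1 \<le> n" using N by simp
    have m0: "0 < real m" by (rule less_le_trans[OF _ m]) simp
    have Cy: "C * real n ^ 2 \<le> y" using N by (simp add: y_def)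
    have "1 * C \<le> real n ^ 2 * C" using n1 c by (intro mult_right_mono) auto
    then have "C \<le> y" using Cy by (simp add: mult.commute)
    moreover have "0 \<le> 8 * (2 ^ q * real q)" "0 \<le> (2::real) ^ (t + 4)" by auto
    ultimately have y: "8 * (2 ^ q * real q) \<le> y" "8 \<le> y" unfolding C_def by linarith+
    have "2 ^ (t + 1) * real n ^ 2 < C * real n ^ 2"
    proof -
      have "(2::real) ^ (t + 1) \<le> 2 ^ (t + 4)" by (intro power_increasing) auto
      then have "2 ^ (t + 1) < C" using \<open>0 \<le> 8 * (2 ^ q * real q)\<close> unfolding C_def by linarith
      then show ?thesis using n1 by (intro mult_strict_right_mono) auto
    qed
    then have yn: "2 ^ (t + 1) * real n ^ 2 < y" using Cy by linarith
    have mv: "real m = v ^ (8 * t)"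
      using m0 t by (simp add: v_def powr_realpow[symmetric] powr_powr)
    have "y ^ 8 = 2 powr (real n / real N)"
      using assms by (simp add: y_def c1_def powr_realpow[symmetric] powr_powr)
    also have "\<dots> \<le> (v ^ t) ^ 8" using m by (simp add: mv power_mult[symmetric] mult.commute)
    finally have vy: "y \<le> v ^ t" by (rule power_le_imp_le_base[of _ 7, simplified]) (simp add: v_def)
    have v1: "1 < v"
    proof (rule ccontr)
      assume "\<not> 1 < v"
      then have "v ^ t \<le> 1" by (intro power_le_one) (auto simp: v_def)
      then show False using vy y by simp
    qed
    have pow: "y \<le> v ^ (k * t)" if "1 \<le> k" for k
    proof -
      have "v ^ (1 * t) \<le> v ^ (k * t)" using that v1 by (intro power_increasing mult_le_mono1) auto
      then show ?thesis using vy by simp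
    qed
    have small: "n * v ^ (4 * t) < \<eta> * m"
    proof -
      have "2 ^ (t + 1) * real n ^ 2 < v ^ (4 * t)" using yn pow[of 4] by simp
      then have "2 ^ (t + 1) * real n ^ 2 * v ^ (4 * t) < v ^ (4 * t) * v ^ (4 * t)"
        using v1 by (intro mult_strict_right_mono) auto
      also have "\<dots> = real m" by (simp add: mv power_add[symmetric])
      finally show ?thesis using n1 by (simp add: \<eta>_def field_simps power2_eq_square)
    qed
    have "2 * q + t + 2 \<le> b"
      using N t unfolding b_def by (subst less_eq_div_iff_mult_less_eq) auto
    then have b: "2 * q \<le> n div t" "t + 2 \<le> b" by (auto simp: b_def)
    interpret avoiding_family m n t F
      using F t m0 n1 by unfold_locales auto
    have "0 < \<eta>" "n * (2 ^ t * \<eta>) \<le> 1 / 2" using n1 by (auto simp: \<eta>_def)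
    then obtain D where D: "is_subcube_codim m n t D"
      "card (F - D) * real m ^ t \<le> real m ^ n * (1 / v ^ t + 2 * real b * s)"
      using near_subcube[OF v1 mv _ _ small q_def b(1) _ _ b_def b(2) s_def] y vy pow[of 5] by auto
    have "1 / v ^ t \<le> 1 / y" using vy y by (intro divide_left_mono) auto
    also have "\<dots> = 2 powr (- c1 * n)" by (simp add: y_def powr_minus_divide)
    also have "\<dots> \<le> 2 powr (- 1 + - real n / real (16 * N * t))"
    proof -
      have "real n / (16 * real N * real t) \<le> real n / (16 * real N * 1)"
        using assms t by (intro divide_left_mono mult_left_mono mult_pos_pos) auto
      moreover have "1 \<le> real n / (16 * real N)" using N assms by (simp add: field_simps)
      moreover have "c1 * n = real n / (16 * real N) + real n / (16 * real N)"
        using assms by (simp add: c1_def field_simps)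
      ultimately have "1 + real n / (16 * real N * real t) \<le> c1 * n" by simp
      then show ?thesis by (intro powr_mono) auto
    qed
    also have "\<dots> = x / 2" by (simp only: powr_add x_def) (simp add: powr_minus_divide)
    finally have 1: "1 / v ^ t \<le> x / 2" .
    have "2 * real b * s \<le> x / 2"
    proof -
      have "real n < t * (real b + 1)"
      proof -
        have "n < t * (b + 1)" using t unfolding b_def by (simp add: dividend_less_times_div)
        then have "real n < real (t * (b + 1))" by (simp only: of_nat_less_iff)
        then show ?thesis by (simp add: distrib_left)
      qed
      then have nb: "real n / t < real b + 1" using t by (simp add: field_simps)
      define e where "e = (b - 2 * t) div 2"
      \<comment> \<open>The \<open>2 * t\<close> lost blocks and the roundings in the two divisions
        cost \<open>t + 1\<close> in the exponent, compared with \<open>n / (2 * t)\<close>.\<close>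
      have "b \<le> 2 * e + 2 * t + 1" unfolding e_def by linarith
      then have "real b \<le> real (2 * e + 2 * t + 1)" by (simp only: of_nat_le_iff)
      then have e: "real n / t / 2 - t - 1 \<le> real e" using nb by simp
      have "s = 2 powr (- real e)"
        unfolding s_def e_def[symmetric] by (simp add: powr_minus_divide powr_realpow power_one_over)
      also have "\<dots> \<le> 2 powr (real (t + 1) + (- (2 * c2 * n)))"
        using e by (intro powr_mono) (auto simp: c2_def)
      also have "\<dots> = 2 ^ (t + 1) * 2 powr (- (2 * c2 * n))"
        by (simp only: powr_add powr_realpow[of 2, simplified])
      finally have s_le: "s \<le> 2 ^ (t + 1) * 2 powr (- (2 * c2 * n))" .
      have "real b \<le> real n ^ 2"
      proof -
        have "b \<le> n" by (simp add: b_def)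
        also have "n \<le> n ^ 2" using n1 by (simp add: power2_eq_square)
        finally have "real b \<le> real (n ^ 2)" by (simp only: of_nat_le_iff)
        then show ?thesis by simp
      qed
      then have "4 * real b * s \<le> 4 * real n ^ 2 * (2 ^ (t + 1) * 2 powr (- (2 * c2 * n)))"
        using s_le by (intro mult_mono) (auto simp: s_def)
      also have "\<dots> = (2 ^ (t + 3) * real n ^ 2) * 2 powr (- (2 * c2 * n))" by (simp add: power_add)
      also have "\<dots> \<le> 2 powr (c2 * n) * 2 powr (- (2 * c2 * n))"
      proof (rule mult_right_mono)
        have "(2::real) ^ (t + 3) \<le> 2 ^ (t + 4)" by (intro power_increasing) auto
        then have "2 ^ (t + 3) \<le> C" using \<open>0 \<le> 8 * (2 ^ q * real q)\<close> unfolding C_def by linarith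
        then have "2 ^ (t + 3) * real n ^ 2 \<le> C * real n ^ 2" by (intro mult_right_mono) auto
        then show "2 ^ (t + 3) * real n ^ 2 \<le> 2 powr (c2 * n)" using N by linarith
      qed simp
      also have "\<dots> = 2 powr (- c2 * n)" by (simp add: powr_add[symmetric])
      also have "\<dots> \<le> x"
      proof -
        have "4 * t \<le> 16 * N * t" using assms by (intro mult_le_mono1) auto
        then have "real (4 * t) \<le> real (16 * N * t)" by (simp only: of_nat_le_iff)
        then have "real n / real (16 * N * t) \<le> real n / real (4 * t)"
          using assms t by (intro divide_left_mono) auto
        then show ?thesis unfolding x_def by (intro powr_mono) (auto simp: c2_def)
      qed
      finally show ?thesis by simp
    qed
    with 1 have "1 / v ^ t + 2 * real b * s \<le> x" by simp
    then have "real m ^ n * (1 / v ^ t + 2 * real b * s) \<le> real m ^ n * x" by (intro mult_left_mono) auto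
    then have fin: "card (F - D) * real m ^ t \<le> real m ^ n * x" using D(2) by linarith
    have "(F - D) \<inter> cube m n = F - D" using F by auto
    then have "mu m n (F - D) = card (F - D) / real m ^ n" by (simp add: mu_def)
    also have "\<dots> \<le> x * (1 / real m ^ t)" using fin m0 by (simp add: field_simps)
    also have "1 / real m ^ t = real m powr (- real t)" using m0 by (simp add: powr_minus_divide powr_realpow)
    finally show "\<exists>D. is_subcube_codim m n t D \<and>
        mu m n (F - D) \<le> 2 powr (- real n / real (16 * N * t)) * real m powr (- real t)"
      using D(1) by (auto simp: x_def)
  qed
qed

end
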